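(* For every finite connected weighted graph $G=(V,(c_{xy})_{x,y\in V})$ and all site weights $\hat\alpha=(\hat\alpha_x)_{x\in V}\in(0,\infty)^V$, $$\lim_{\varepsilon\to 0}\frac{{\rm gap}_k(G,\varepsilon\hat\alpha)}{{\rm gap}_2(G,\varepsilon\hat\alpha)}=1,\qquad \text{for all integers } k\ge 2,$$ where $\varepsilon>0$ and $\varepsilon\hat\alpha=(\varepsilon\hat\alpha_x)_{x\in V}$.
   Context: $G=(V,(c_{xy})_{x,y\in V})$ is a finite graph with $|V|\ge2$, symmetric conductances $c_{xy}=c_{yx}\ge 0$, $c_{xx}=0$, connected: any two sites are joined by a sequence of sites with positive conductance between consecutive ones. For positive site weights $\alpha=(\alpha_x)_{x\in V}$ and $k\in\mathbb N$ let $\Xi_k=\{\eta\in\mathbb N_0^V:\sum_{x\in V}\eta_x=k\}$. The symmetric inclusion process ${\rm SIP}_k(G,\alpha)$ is the continuous-time Markov chain on $\Xi_k$ with generator, for $f\in\mathbb R^{\Xi_k}$, $$L_{G,\alpha,k}f(\eta)=\sum_{x,y\in V}c_{xy}\,\eta_x(\alpha_y+\eta_y)\big(f(\eta-\delta_x+\delta_y)-f(\eta)\big).$$ It is irreducible and reversible, so all eigenvalues of $-L_{G,\alpha,k}$ are real and non-negative, with $0$ simple; ${\rm gap}_k(G,\alpha)>0$ denotes the second smallest eigenvalue of $-L_{G,\alpha,k}$. *)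

theory Defs
  imports "HOL-Analysis.Analysis"
begin

text \<open>The vertex set is the whole of a finite type; the graph is given by its conductances.\<close>

definition connected_weighted_graph :: "('v::finite \<Rightarrow> 'v \<Rightarrow> real) \<Rightarrow> bool" where
  "connected_weighted_graph c \<longleftrightarrow>
     CARD('v) \<ge> 2 \<and>
     (\<forall>x y. c x y = c y x) \<and>
     (\<forall>x y. c x y \<ge> 0) \<and>
     (\<forall>x. c x x = 0) \<and>
     (\<forall>x y. (\<lambda>u v. c u v > 0)\<^sup>*\<^sup>* x y)"

definition configs :: "nat \<Rightarrow> ('v::finite \<Rightarrow> nat) set" where
  "configs k = {\<eta>. (\<Sum>x\<in>UNIV. \<eta> x) = k}"

definition delta :: "'v \<Rightarrow> 'v \<Rightarrow> nat" where
  "delta x z = (if z = x then 1 else 0)"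

text \<open>Subtraction on \<^typ>\<open>nat\<close> truncates in \<open>move\<close> only if \<open>\<eta> x = 0\<close>. In that case the rate
  in \<open>sip_generator\<close> vanishes, so the value of \<open>f\<close> there is irrelevant. In particular, on
  \<open>configs k\<close> the generator depends only on the restriction of \<open>f\<close> to \<open>configs k\<close>.\<close>

definition move :: "'v \<Rightarrow> 'v \<Rightarrow> ('v \<Rightarrow> nat) \<Rightarrow> ('v \<Rightarrow> nat)" where
  "move x y \<eta> = (\<lambda>z. \<eta> z - delta x z + delta y z)"

definition sip_generator ::
  "('v::finite \<Rightarrow> 'v \<Rightarrow> real) \<Rightarrow> ('v \<Rightarrow> real) \<Rightarrow> (('v \<Rightarrow> nat) \<Rightarrow> real) \<Rightarrow> ('v \<Rightarrow> nat) \<Rightarrow> real" where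
  "sip_generator c \<alpha> f \<eta> =
     (\<Sum>x\<in>UNIV. \<Sum>y\<in>UNIV.
        c x y * real (\<eta> x) * (\<alpha> y + real (\<eta> y)) * (f (move x y \<eta>) - f \<eta>))"

text \<open>The real eigenvalues of the negative generator on functions on \<open>configs k\<close>; such functions
  are represented by arbitrary functions, of which only the values on \<open>configs k\<close> matter.\<close>

definition sip_eigenvalues ::
  "('v::finite \<Rightarrow> 'v \<Rightarrow> real) \<Rightarrow> ('v \<Rightarrow> real) \<Rightarrow> nat \<Rightarrow> real set" where
  "sip_eigenvalues c \<alpha> k =
     {\<mu>. \<exists>f. (\<exists>\<eta>\<in>configs k. f \<eta> \<noteq> 0) \<and>
             (\<forall>\<eta>\<in>configs k. - sip_generator c \<alpha> f \<eta> = \<mu> * f \<eta>)}"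

text \<open>The second smallest eigenvalue. By irreducibility the smallest eigenvalue \<open>0\<close> is simple,
  so it makes no difference whether eigenvalues are counted with multiplicity.\<close>

definition sip_gap :: "('v::finite \<Rightarrow> 'v \<Rightarrow> real) \<Rightarrow> ('v \<Rightarrow> real) \<Rightarrow> nat \<Rightarrow> real" where
  "sip_gap c \<alpha> k = Min (sip_eigenvalues c \<alpha> k - {Min (sip_eigenvalues c \<alpha> k)})"

end

theory Submission
  imports Defs "Jordan_Normal_Form.Spectral_Radius"
begin

text \<open>For small weights the process has two time scales: particles attract each other at rates of
  order one and diffuse at rates of order \<open>\<epsilon>\<close>. The proof rests on the fact that the attraction is
  invisible to linear statistics of the configuration, and that on quadratic statistics it acts only
  between the two particles of a pair (\<open>sip_generator_lin_form\<close>, \<open>sip_generator_pair_form\<close>). Summing a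
  one-particle or two-particle eigenfunction over the particles or pairs therefore gives an
  eigenfunction for any larger number of particles. In particular \<open>gap\<^sub>k \<le> gap\<^sub>2\<close>.

  For the reverse inequality, note which configurations survive on the slow time scale: the condensates,
  with all particles at one site, and the configurations whose occupied sites are pairwise not adjacent.
  A condensate moves like a single walk, and the eigenvalues of the walk occur for every number of
  particles. The decay of the other configurations is governed by pairs of particles: let \<open>\<mu>\<close> be the
  lowest eigenvalue of two independent walks that are killed when they meet or become adjacent, for
  the weights before scaling. A positive supersolution for the killed pair, summed over all pairs of
  particles, is positive away from the condensates, whatever the number of particles. Used as a
  barrier in a maximum principle it shows that an eigenfunction with an eigenvalue below
  \<open>\<epsilon> (\<mu> - \<delta>)\<close> is linear, so that its eigenvalue belongs to the single walk
  (\<open>eigenvalue_below_barrier_is_walk_eigenvalue\<close>, \<open>metastable_barrier\<close>,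
  \<open>low_eigenvalues_are_two_particle_eigenvalues\<close>).

  On the other hand the ground state of the killed pair is a test function for the two-particle process
  and shows that \<open>gap\<^sub>2\<close> is at most \<open>\<epsilon> \<mu> (1 + O(\<epsilon>))\<close> (\<open>two_particle_gap_metastable_bound\<close>). So
  either \<open>gap\<^sub>k\<close> lies below \<open>\<epsilon> (\<mu> - \<delta>)\<close>, is an eigenvalue for two particles, and equals \<open>gap\<^sub>2\<close>; or the
  ratio of the gaps is at least \<open>(\<mu> - \<delta>) / \<mu>\<close> up to an error of order \<open>\<epsilon>\<close>. On a complete graph there
  are no pairs to be killed, every level is admissible for the barrier, and the gaps agree for small
  \<open>\<epsilon>\<close>.\<close>

(* Plain "subspace" is to denote the subspaces of real vector spaces. *)
hide_const (open) VectorSpace.subspace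

section \<open>Configurations and moves\<close>

lemma finite_configs: "finite (configs k :: ('v::finite \<Rightarrow> nat) set)"
proof (rule finite_subset)
  show "(configs k :: ('v \<Rightarrow> nat) set) \<subseteq> (UNIV \<rightarrow>\<^sub>E {..k})"
    by (auto simp: configs_def intro: member_le_sum)
qed (simp add: finite_PiE)

lemma move_in_configs:
  assumes "\<eta> \<in> configs k" "\<eta> x > 0"
  shows "move x y \<eta> \<in> configs k"
proof -
  have "(\<Sum>z\<in>UNIV. int (move x y \<eta> z)) = (\<Sum>z\<in>UNIV. int (\<eta> z) - (if z = x then 1 else 0) + (if z = y then 1 else 0))"
    using assms by (intro sum.cong refl) (auto simp: move_def delta_def)
  also have "\<dots> = (\<Sum>z\<in>UNIV. int (\<eta> z))"
    by (simp add: sum.distrib sum_subtractf)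
  finally show ?thesis using assms by (simp add: configs_def flip: of_nat_sum)
qed

lemma real_move:
  assumes "\<eta> x > 0"
  shows "real (move x y \<eta> z) = real (\<eta> z) + (of_bool (z = y) - of_bool (z = x))"
  using assms by (auto simp: move_def delta_def)

section \<open>The generator on linear and quadratic functions\<close>

text \<open>A kernel summed over the ordered pairs of distinct particles. The correction on the
  diagonal removes the pairs of a particle with itself; without it the quadratic functions would
  not be mapped to quadratic functions of the same shape by the generator.\<close>

definition pair_form :: "('v::finite \<Rightarrow> 'v \<Rightarrow> real) \<Rightarrow> ('v \<Rightarrow> nat) \<Rightarrow> real" where
  "pair_form \<phi> \<eta> = (\<Sum>x\<in>UNIV. \<Sum>y\<in>UNIV. \<phi> x y * real (\<eta> x) * (real (\<eta> y) - of_bool (x = y)))"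

text \<open>The motion of the first of two labelled particles: it is attracted by the second one,
  which contributes the additional rate towards its own site.\<close>

definition jump_generator ::
  "('v::finite \<Rightarrow> 'v \<Rightarrow> real) \<Rightarrow> ('v \<Rightarrow> real) \<Rightarrow> ('v \<Rightarrow> 'v \<Rightarrow> real) \<Rightarrow> 'v \<Rightarrow> 'v \<Rightarrow> real" where
  "jump_generator c \<beta> \<phi> x y = (\<Sum>u\<in>UNIV. c x u * (\<beta> u + of_bool (u = y)) * (\<phi> u y - \<phi> x y))"

text \<open>For a symmetric kernel this is the generator of the two-particle process: by symmetry the
  motion of the second particle is that of the first with the sites exchanged.\<close>

definition pair_generator ::
  "('v::finite \<Rightarrow> 'v \<Rightarrow> real) \<Rightarrow> ('v \<Rightarrow> real) \<Rightarrow> ('v \<Rightarrow> 'v \<Rightarrow> real) \<Rightarrow> 'v \<Rightarrow> 'v \<Rightarrow> real" where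
  "pair_generator c \<beta> \<phi> x y = jump_generator c \<beta> \<phi> x y + jump_generator c \<beta> \<phi> y x"

definition walk_generator ::
  "('v::finite \<Rightarrow> 'v \<Rightarrow> real) \<Rightarrow> ('v \<Rightarrow> real) \<Rightarrow> ('v \<Rightarrow> real) \<Rightarrow> 'v \<Rightarrow> real" where
  "walk_generator c \<beta> a x = (\<Sum>y\<in>UNIV. c x y * \<beta> y * (a y - a x))"

definition lin_form :: "('v::finite \<Rightarrow> real) \<Rightarrow> ('v \<Rightarrow> nat) \<Rightarrow> real" where
  "lin_form a \<eta> = (\<Sum>x\<in>UNIV. a x * real (\<eta> x))"

lemma sum_antisym:
  fixes h :: "'v::finite \<Rightarrow> 'v \<Rightarrow> real"
  assumes "\<And>x y. h y x = - h x y"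
  shows "(\<Sum>x\<in>UNIV. \<Sum>y\<in>UNIV. h x y) = 0"
proof -
  have "(\<Sum>x\<in>UNIV. \<Sum>y\<in>UNIV. h x y) = (\<Sum>x\<in>UNIV. \<Sum>y\<in>UNIV. h y x)"
    by (rule sum.swap)
  also have "\<dots> = (\<Sum>x\<in>UNIV. \<Sum>y\<in>UNIV. - h x y)"
    by (intro sum.cong refl) (rule assms)
  also have "\<dots> = - (\<Sum>x\<in>UNIV. \<Sum>y\<in>UNIV. h x y)"
    by (simp only: sum_negf)
  finally show ?thesis by simp
qed

text \<open>The bracket is the change of the occupation numbers under one jump, so this evaluates
  the change of any linear statistic.\<close>

lemma sum_displacement:
  fixes h :: "'v::finite \<Rightarrow> real"
  shows "(\<Sum>z\<in>UNIV. (of_bool (z = y) - of_bool (z = x)) * h z) = h y - h x"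
  by (simp add: left_diff_distrib sum_subtractf of_bool_def if_distrib[of "\<lambda>t. t * _"] cong: if_cong)

lemma lin_form_move:
  assumes "\<eta> x > 0"
  shows "lin_form a (move x y \<eta>) - lin_form a \<eta> = a y - a x"
proof -
  have "lin_form a (move x y \<eta>) - lin_form a \<eta> = (\<Sum>z\<in>UNIV. (of_bool (z = y) - of_bool (z = x)) * a z)"
    unfolding lin_form_def using assms
    by (simp add: real_move sum_subtractf[symmetric] algebra_simps del: sum_mult_of_bool_eq sum_of_bool_mult_eq)
  then show ?thesis by (simp only: sum_displacement)
qed

text \<open>The attraction between particles cancels: the rate at which \<open>x\<close> attracts a particle from
  \<open>y\<close> equals the rate of the opposite event, by the symmetry of the conductances, and the two events
  change a linear function by opposite amounts. What remains is one independent walk per particle.\<close>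

lemma sip_generator_lin_form:
  fixes c :: "'v::finite \<Rightarrow> 'v \<Rightarrow> real"
  assumes sym: "\<And>x y. c x y = c y x"
  shows "sip_generator c \<beta> (lin_form a) \<eta> = lin_form (walk_generator c \<beta> a) \<eta>"
proof -
  have "sip_generator c \<beta> (lin_form a) \<eta>
      = (\<Sum>x\<in>UNIV. \<Sum>y\<in>UNIV. c x y * real (\<eta> x) * (\<beta> y + real (\<eta> y)) * (a y - a x))"
    unfolding sip_generator_def
  proof (intro sum.cong refl)
    fix x y
    show "c x y * real (\<eta> x) * (\<beta> y + real (\<eta> y)) * (lin_form a (move x y \<eta>) - lin_form a \<eta>)
        = c x y * real (\<eta> x) * (\<beta> y + real (\<eta> y)) * (a y - a x)"
      by (cases "\<eta> x = 0") (simp_all add: lin_form_move)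
  qed
  also have "\<dots> = (\<Sum>x\<in>UNIV. \<Sum>y\<in>UNIV. c x y * \<beta> y * (a y - a x) * real (\<eta> x))
      + (\<Sum>x\<in>UNIV. \<Sum>y\<in>UNIV. c x y * real (\<eta> x) * real (\<eta> y) * (a y - a x))"
    by (simp add: algebra_simps sum.distrib sum_subtractf)
  also have "(\<Sum>x\<in>UNIV. \<Sum>y\<in>UNIV. c x y * real (\<eta> x) * real (\<eta> y) * (a y - a x)) = 0"
  proof (rule sum_antisym)
    fix x y
    show "c y x * real (\<eta> y) * real (\<eta> x) * (a x - a y) = - (c x y * real (\<eta> x) * real (\<eta> y) * (a y - a x))"
      unfolding sym[of y x] by (simp add: algebra_simps)
  qed
  finally show ?thesis
    by (simp add: lin_form_def[of "walk_generator c \<beta> a"] walk_generator_def sum_distrib_right)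
qed

lemma pair_form_move:
  fixes \<phi> :: "'v::finite \<Rightarrow> 'v \<Rightarrow> real"
  assumes sym: "\<And>x y. \<phi> x y = \<phi> y x" and "\<eta> x > 0"
  shows "pair_form \<phi> (move x y \<eta>) - pair_form \<phi> \<eta>
      = 2 * (\<Sum>b\<in>UNIV. (\<phi> y b - \<phi> x b) * (real (\<eta> b) - of_bool (b = x)))"
proof -
  define e where "e z = (of_bool (z = y) - of_bool (z = x) :: real)" for z
  have e: "(\<Sum>z\<in>UNIV. e z * h z) = h y - h x" for h
    unfolding e_def by (rule sum_displacement)
  have "pair_form \<phi> (move x y \<eta>) - pair_form \<phi> \<eta>
      = (\<Sum>a\<in>UNIV. \<Sum>b\<in>UNIV. e a * (\<phi> a b * (real (\<eta> b) - of_bool (a = b))))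
      + (\<Sum>a\<in>UNIV. \<Sum>b\<in>UNIV. e b * (\<phi> a b * real (\<eta> a)))
      + (\<Sum>a\<in>UNIV. \<Sum>b\<in>UNIV. e a * (e b * \<phi> a b))"
    unfolding pair_form_def real_move[of \<eta> x, OF assms(2)] e_def[symmetric]
      sum.distrib[symmetric] sum_subtractf[symmetric]
    by (intro sum.cong refl) (simp add: algebra_simps)
  also have "(\<Sum>a\<in>UNIV. \<Sum>b\<in>UNIV. e a * (\<phi> a b * (real (\<eta> b) - of_bool (a = b))))
      = (\<Sum>b\<in>UNIV. \<phi> y b * (real (\<eta> b) - of_bool (y = b)))
        - (\<Sum>b\<in>UNIV. \<phi> x b * (real (\<eta> b) - of_bool (x = b)))"
    by (simp only: sum_distrib_left[symmetric] e)
  also have "(\<Sum>b\<in>UNIV. \<phi> y b * (real (\<eta> b) - of_bool (y = b))) = (\<Sum>b\<in>UNIV. \<phi> y b * real (\<eta> b)) - \<phi> y y"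
    by (simp add: algebra_simps sum_subtractf)
  also have "(\<Sum>b\<in>UNIV. \<phi> x b * (real (\<eta> b) - of_bool (x = b))) = (\<Sum>b\<in>UNIV. \<phi> x b * real (\<eta> b)) - \<phi> x x"
    by (simp add: algebra_simps sum_subtractf)
  also have "(\<Sum>a\<in>UNIV. \<Sum>b\<in>UNIV. e b * (\<phi> a b * real (\<eta> a)))
      = (\<Sum>a\<in>UNIV. \<phi> y a * real (\<eta> a)) - (\<Sum>a\<in>UNIV. \<phi> x a * real (\<eta> a))"
    by (simp only: e sum_subtractf sym[of _ x] sym[of _ y])
  also have "(\<Sum>a\<in>UNIV. \<Sum>b\<in>UNIV. e a * (e b * \<phi> a b)) = \<phi> y y - \<phi> y x - (\<phi> x y - \<phi> x x)"
    by (simp only: sum_distrib_left[symmetric] e)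
  moreover have "(\<Sum>b\<in>UNIV. (\<phi> y b - \<phi> x b) * (real (\<eta> b) - of_bool (b = x)))
      = (\<Sum>b\<in>UNIV. \<phi> y b * real (\<eta> b)) - (\<Sum>b\<in>UNIV. \<phi> x b * real (\<eta> b)) - \<phi> y x + \<phi> x x"
    by (simp add: algebra_simps sum_subtractf sum.distrib)
  ultimately show ?thesis using sym[of x y] by simp
qed

text \<open>Diffusion and attraction, separated.\<close>

lemma jump_generator_split:
  "jump_generator c \<beta> \<phi> x y
    = (\<Sum>u\<in>UNIV. c x u * \<beta> u * (\<phi> u y - \<phi> x y)) + c x y * (\<phi> y y - \<phi> x y)"
proof -
  have "jump_generator c \<beta> \<phi> x y = (\<Sum>u\<in>UNIV. c x u * \<beta> u * (\<phi> u y - \<phi> x y))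
      + (\<Sum>u\<in>UNIV. of_bool (u = y) * (c x u * (\<phi> u y - \<phi> x y)))"
    unfolding jump_generator_def sum.distrib[symmetric] by (intro sum.cong refl) (simp add: algebra_simps)
  then show ?thesis by simp
qed

text \<open>The number of ordered pairs with a first particle at \<open>x\<close> and a second at \<open>y\<close> is symmetric
  in the two sites.\<close>

lemma pair_form_symmetrise:
  "pair_form (\<lambda>x y. h x y + h y x) \<eta> = 2 * pair_form h \<eta>"
proof -
  have "pair_form (\<lambda>x y. h y x) \<eta> = (\<Sum>y\<in>UNIV. \<Sum>x\<in>UNIV. h y x * real (\<eta> x) * (real (\<eta> y) - of_bool (x = y)))"
    unfolding pair_form_def by (rule sum.swap)
  also have "\<dots> = pair_form h \<eta>"
    unfolding pair_form_def by (intro sum.cong refl) auto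
  finally show ?thesis
    by (simp add: pair_form_def algebra_simps sum.distrib sum_subtractf)
qed

text \<open>The self-duality behind the whole proof: the attraction exerted by third particles cancels
  for the same reason as in the linear case, so each pair of particles evolves on its own like a
  two-particle process.\<close>

lemma sip_generator_pair_form:
  fixes c \<phi> :: "'v::finite \<Rightarrow> 'v \<Rightarrow> real"
  assumes sym: "\<And>x y. c x y = c y x" and loop: "\<And>x. c x x = 0"
    and \<phi>: "\<And>x y. \<phi> x y = \<phi> y x"
  shows "sip_generator c \<beta> (pair_form \<phi>) \<eta> = pair_form (pair_generator c \<beta> \<phi>) \<eta>"
proof -
  let ?d = "\<lambda>x y b. \<phi> y b - \<phi> x b"
  have "sip_generator c \<beta> (pair_form \<phi>) \<eta>
      = (\<Sum>x\<in>UNIV. \<Sum>y\<in>UNIV. c x y * real (\<eta> x) * (\<beta> y + real (\<eta> y)) *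
           (2 * (\<Sum>b\<in>UNIV. ?d x y b * (real (\<eta> b) - of_bool (b = x)))))"
    unfolding sip_generator_def
  proof (intro sum.cong refl)
    fix x y
    show "c x y * real (\<eta> x) * (\<beta> y + real (\<eta> y)) * (pair_form \<phi> (move x y \<eta>) - pair_form \<phi> \<eta>)
        = c x y * real (\<eta> x) * (\<beta> y + real (\<eta> y)) *
           (2 * (\<Sum>b\<in>UNIV. ?d x y b * (real (\<eta> b) - of_bool (b = x))))"
      by (cases "\<eta> x = 0") (simp_all add: pair_form_move[OF \<phi>])
  qed
  also have "\<dots> = 2 * (\<Sum>x\<in>UNIV. \<Sum>y\<in>UNIV. \<Sum>b\<in>UNIV. c x y * \<beta> y * ?d x y b * real (\<eta> x) * (real (\<eta> b) - of_bool (x = b)))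
     + 2 * (\<Sum>x\<in>UNIV. \<Sum>y\<in>UNIV. \<Sum>b\<in>UNIV. c x y * real (\<eta> x) * real (\<eta> y) * ?d x y b * real (\<eta> b))
     - 2 * (\<Sum>x\<in>UNIV. \<Sum>y\<in>UNIV. \<Sum>b\<in>UNIV. c x y * real (\<eta> x) * real (\<eta> y) * ?d x y b * of_bool (b = x))"
    unfolding sum_distrib_left sum.distrib[symmetric] sum_subtractf[symmetric]
    by (intro sum.cong refl) (auto simp: algebra_simps)
  also have "(\<Sum>x\<in>UNIV. \<Sum>y\<in>UNIV. \<Sum>b\<in>UNIV. c x y * real (\<eta> x) * real (\<eta> y) * ?d x y b * real (\<eta> b)) = 0"
  proof (rule sum_antisym)
    fix x y
    show "(\<Sum>b\<in>UNIV. c y x * real (\<eta> y) * real (\<eta> x) * ?d y x b * real (\<eta> b))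
        = - (\<Sum>b\<in>UNIV. c x y * real (\<eta> x) * real (\<eta> y) * ?d x y b * real (\<eta> b))"
      unfolding sym[of y x] sum_negf[symmetric] by (intro sum.cong refl) (simp add: algebra_simps)
  qed
  also have "(\<Sum>x\<in>UNIV. \<Sum>y\<in>UNIV. \<Sum>b\<in>UNIV. c x y * real (\<eta> x) * real (\<eta> y) * ?d x y b * of_bool (b = x))
      = (\<Sum>x\<in>UNIV. \<Sum>y\<in>UNIV. c x y * real (\<eta> x) * real (\<eta> y) * (\<phi> y x - \<phi> x x))"
    by simp
  also have "\<dots> = (\<Sum>y\<in>UNIV. \<Sum>x\<in>UNIV. c x y * real (\<eta> x) * real (\<eta> y) * (\<phi> y x - \<phi> x x))"
    by (rule sum.swap)
  also have "\<dots> = - (\<Sum>x\<in>UNIV. \<Sum>y\<in>UNIV. c x y * (\<phi> y y - \<phi> x y) * real (\<eta> x) * (real (\<eta> y) - of_bool (x = y)))"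
    unfolding sum_negf[symmetric]
  proof (intro sum.cong refl)
    fix x y
    show "c y x * real (\<eta> y) * real (\<eta> x) * (\<phi> x y - \<phi> y y)
        = - (c x y * (\<phi> y y - \<phi> x y) * real (\<eta> x) * (real (\<eta> y) - of_bool (x = y)))"
      using sym[of y x] loop[of x] by (auto simp: algebra_simps)
  qed
  also have "(\<Sum>x\<in>UNIV. \<Sum>y\<in>UNIV. \<Sum>b\<in>UNIV. c x y * \<beta> y * ?d x y b * real (\<eta> x) * (real (\<eta> b) - of_bool (x = b)))
     = (\<Sum>x\<in>UNIV. \<Sum>b\<in>UNIV. (\<Sum>y\<in>UNIV. c x y * \<beta> y * ?d x y b) * real (\<eta> x) * (real (\<eta> b) - of_bool (x = b)))"
    unfolding sum_distrib_right by (intro sum.cong refl sum.swap)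
  also have "2 * \<dots> + 2 * 0 - 2 * (- (\<Sum>x\<in>UNIV. \<Sum>y\<in>UNIV. c x y * (\<phi> y y - \<phi> x y) * real (\<eta> x) * (real (\<eta> y) - of_bool (x = y))))
     = 2 * pair_form (jump_generator c \<beta> \<phi>) \<eta>"
    unfolding pair_form_def jump_generator_split
    by (simp add: distrib_right sum.distrib)
  also have "\<dots> = pair_form (pair_generator c \<beta> \<phi>) \<eta>"
    unfolding pair_generator_def by (rule pair_form_symmetrise[symmetric])
  finally show ?thesis .
qed

section \<open>Finiteness of the spectra\<close>

text \<open>Enumerating the finite set turns the operator into a matrix, and the spectrum of a
  matrix is finite. This is what makes the minima in the definition of the gap meaningful.\<close>

lemma finite_eigenvalues_of_kernel:
  fixes A :: "('a \<Rightarrow> real) \<Rightarrow> 'a \<Rightarrow> real"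
  assumes S: "finite S" and A: "\<And>f s. s \<in> S \<Longrightarrow> A f s = (\<Sum>t\<in>S. K s t * f t)"
  shows "finite {\<mu>. \<exists>f. (\<exists>s\<in>S. f s \<noteq> 0) \<and> (\<forall>s\<in>S. A f s = \<mu> * f s)}"
proof -
  define n where "n = card S"
  obtain h where h: "bij_betw h {0..<n} S"
    using ex_bij_betw_nat_finite[OF S] unfolding n_def by blast
  define B where "B = mat n n (\<lambda>(i, j). K (h i) (h j))"
  have B: "B \<in> carrier_mat n n" by (simp add: B_def)
  have "\<mu> \<in> spectrum B" if f: "\<exists>s\<in>S. f s \<noteq> 0" "\<forall>s\<in>S. A f s = \<mu> * f s" for f \<mu>
  proof -
    define v where "v = vec n (\<lambda>i. f (h i))"
    obtain i where i: "i < n" "f (h i) \<noteq> 0"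
      using f(1) h by (auto simp: bij_betw_def)
    have "v \<noteq> 0\<^sub>v n"
      using i by (auto simp: v_def vec_eq_iff)
    moreover have "B *\<^sub>v v = \<mu> \<cdot>\<^sub>v v"
    proof (rule eq_vecI)
      fix j assume "j < dim_vec (\<mu> \<cdot>\<^sub>v v)"
      then have j: "j < n" by (simp add: v_def)
      then have hj: "h j \<in> S" using h by (auto simp: bij_betw_def)
      have "vec_index (B *\<^sub>v v) j = (\<Sum>l\<in>{0..<n}. K (h j) (h l) * f (h l))"
        using j by (simp add: B_def v_def scalar_prod_def)
      also have "\<dots> = (\<Sum>t\<in>S. K (h j) t * f t)"
        by (rule sum.reindex_bij_betw[OF h])
      also have "\<dots> = \<mu> * f (h j)" using A[OF hj, of f] f(2) hj by simp
      finally show "vec_index (B *\<^sub>v v) j = vec_index (\<mu> \<cdot>\<^sub>v v) j"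
        using j by (simp add: v_def)
    qed (simp add: B_def v_def)
    ultimately show ?thesis
      unfolding spectrum_def eigenvalue_def eigenvector_def
      by (intro CollectI exI[of _ v]) (simp add: B_def v_def)
  qed
  then have "{\<mu>. \<exists>f. (\<exists>s\<in>S. f s \<noteq> 0) \<and> (\<forall>s\<in>S. A f s = \<mu> * f s)} \<subseteq> spectrum B"
    by blast
  then show ?thesis using card_finite_spectrum(1)[OF B] by (rule finite_subset)
qed

text \<open>A move with positive rate conserves the number of particles.\<close>

lemma sip_generator_cong:
  assumes "\<eta> \<in> configs k" "\<And>\<zeta>. \<zeta> \<in> configs k \<Longrightarrow> f \<zeta> = g \<zeta>"
  shows "sip_generator c \<beta> f \<eta> = sip_generator c \<beta> g \<eta>"
  unfolding sip_generator_def
proof (intro sum.cong refl)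
  fix x y
  show "c x y * real (\<eta> x) * (\<beta> y + real (\<eta> y)) * (f (move x y \<eta>) - f \<eta>)
      = c x y * real (\<eta> x) * (\<beta> y + real (\<eta> y)) * (g (move x y \<eta>) - g \<eta>)"
    using assms move_in_configs[OF assms(1), of x y] by (cases "\<eta> x = 0") auto
qed

lemma sip_generator_add:
  "sip_generator c \<beta> (\<lambda>\<zeta>. f \<zeta> + g \<zeta>) \<eta> = sip_generator c \<beta> f \<eta> + sip_generator c \<beta> g \<eta>"
  by (simp add: sip_generator_def algebra_simps sum.distrib sum_subtractf)

lemma sip_generator_scale:
  "sip_generator c \<beta> (\<lambda>\<zeta>. r * f \<zeta>) \<eta> = r * sip_generator c \<beta> f \<eta>"
  by (simp add: sip_generator_def algebra_simps sum_subtractf sum_distrib_left)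

lemma sip_generator_sum:
  "sip_generator c \<beta> (\<lambda>\<zeta>. \<Sum>t\<in>S. f t \<zeta>) \<eta> = (\<Sum>t\<in>S. sip_generator c \<beta> (f t) \<eta>)"
proof (induction S rule: infinite_finite_induct)
  case (insert t S)
  then show ?case by (simp add: sip_generator_add)
qed (simp_all add: sip_generator_def)

lemma finite_sip_eigenvalues: "finite (sip_eigenvalues c \<beta> k)"
  unfolding sip_eigenvalues_def
proof (rule finite_eigenvalues_of_kernel[OF finite_configs])
  fix f and \<eta> :: "'a \<Rightarrow> nat" assume \<eta>: "\<eta> \<in> configs k"
  have "sip_generator c \<beta> f \<eta> = sip_generator c \<beta> (\<lambda>\<zeta>. \<Sum>\<xi>\<in>configs k. f \<xi> * of_bool (\<zeta> = \<xi>)) \<eta>"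
    by (rule sip_generator_cong[OF \<eta>]) (simp add: finite_configs)
  also have "\<dots> = (\<Sum>\<xi>\<in>configs k. f \<xi> * sip_generator c \<beta> (\<lambda>\<zeta>. of_bool (\<zeta> = \<xi>)) \<eta>)"
    by (simp only: sip_generator_sum sip_generator_scale)
  finally show "- sip_generator c \<beta> f \<eta>
      = (\<Sum>\<xi>\<in>configs k. - sip_generator c \<beta> (\<lambda>\<zeta>. of_bool (\<zeta> = \<xi>)) \<eta> * f \<xi>)"
    by (simp add: sum_negf mult.commute)
qed

section \<open>Eigenvalues inherited from fewer particles\<close>

text \<open>The maximum principle: all rates are non-negative, and at a maximum all increments are
  non-positive.\<close>

lemma sip_generator_at_max:
  assumes "\<And>x y. c x y \<ge> 0" "\<And>x. \<beta> x \<ge> 0" "\<eta> \<in> configs k"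
    and "\<And>\<zeta>. \<zeta> \<in> configs k \<Longrightarrow> f \<zeta> \<le> f \<eta>"
  shows "sip_generator c \<beta> f \<eta> \<le> 0"
  unfolding sip_generator_def
proof (intro sum_nonpos)
  fix x y
  show "c x y * real (\<eta> x) * (\<beta> y + real (\<eta> y)) * (f (move x y \<eta>) - f \<eta>) \<le> 0"
    using assms move_in_configs[OF assms(3), of x y]
    by (cases "\<eta> x = 0") (auto intro!: mult_nonneg_nonpos mult_nonneg_nonneg add_nonneg_nonneg)
qed

definition condensate :: "nat \<Rightarrow> 'v \<Rightarrow> 'v \<Rightarrow> nat" where
  "condensate k x z = (if z = x then k else 0)"

lemma condensate_in_configs: "condensate k x \<in> configs k"
  by (simp add: condensate_def configs_def)

lemma pair_form_condensate: "pair_form \<phi> (condensate k x) = real k * (real k - 1) * \<phi> x x"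
proof -
  have "pair_form \<phi> (condensate k x) = (\<Sum>a\<in>UNIV. if a = x then real k * (real k - 1) * \<phi> x x else 0)"
    unfolding pair_form_def
  proof (intro sum.cong refl)
    fix a
    have "(\<Sum>y\<in>UNIV. \<phi> a y * real (condensate k x a) * (real (condensate k x y) - of_bool (a = y)))
        = (\<Sum>y\<in>UNIV. if y = x then (if a = x then real k * (real k - 1) * \<phi> x x else 0) else 0)"
      by (intro sum.cong refl) (auto simp: condensate_def)
    then show "(\<Sum>y\<in>UNIV. \<phi> a y * real (condensate k x a) * (real (condensate k x y) - of_bool (a = y)))
        = (if a = x then real k * (real k - 1) * \<phi> x x else 0)" by simp
  qed
  then show ?thesis by simp
qed

lemma lin_form_condensate: "lin_form a (condensate k x) = a x * real k"
  by (simp add: lin_form_def condensate_def if_distrib cong: if_cong)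

lemma pair_form_move_condensate:
  assumes "\<And>x y. \<phi> x y = \<phi> y x" "k \<ge> 1"
  shows "pair_form \<phi> (move x y (condensate k x))
      = real k * (real k - 1) * \<phi> x x + 2 * (real k - 1) * (\<phi> x y - \<phi> x x)"
proof -
  have "condensate k x x > 0" using assms(2) by (simp add: condensate_def)
  from pair_form_move[of \<phi> "condensate k x" x y, OF assms(1) this]
  have "pair_form \<phi> (move x y (condensate k x)) = real k * (real k - 1) * \<phi> x x
      + 2 * (\<Sum>b\<in>UNIV. (\<phi> y b - \<phi> x b) * (real (condensate k x b) - of_bool (b = x)))"
    by (simp add: pair_form_condensate)
  also have "(\<Sum>b\<in>UNIV. (\<phi> y b - \<phi> x b) * (real (condensate k x b) - of_bool (b = x)))
      = (\<Sum>b\<in>UNIV. if b = x then (\<phi> y x - \<phi> x x) * (real k - 1) else 0)"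
    by (intro sum.cong refl) (auto simp: condensate_def)
  finally show ?thesis using assms(1)[of y x] by (simp add: algebra_simps)
qed

text \<open>The condensates determine the diagonal of the kernel; the configurations with exactly one
  particle away from a condensate then determine the rest. Hence eigenkernels of two particles do not
  disappear when they are lifted to more particles.\<close>

lemma pair_form_eq_0D:
  assumes "\<And>x y. \<phi> x y = \<phi> y x" "k \<ge> 2" "\<And>\<eta>. \<eta> \<in> configs k \<Longrightarrow> pair_form \<phi> \<eta> = 0"
  shows "\<phi> x y = 0"
proof -
  have diag: "\<phi> x x = 0"
    using assms(3)[OF condensate_in_configs, of x] assms(2) by (simp add: pair_form_condensate)
  have "condensate k x x > 0" using assms(2) by (simp add: condensate_def)
  from assms(3)[OF move_in_configs[OF condensate_in_configs this, of y]] show ?thesis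
    using assms(2) diag by (subst (asm) pair_form_move_condensate[OF assms(1)]) auto
qed

lemma sip_eigenvalue_pairI:
  fixes c \<phi> :: "'v::finite \<Rightarrow> 'v \<Rightarrow> real"
  assumes c: "\<And>x y. c x y = c y x" "\<And>x. c x x = 0" and \<phi>: "\<And>x y. \<phi> x y = \<phi> y x"
    and ev: "\<And>x y. pair_generator c \<beta> \<phi> x y = - \<mu> * \<phi> x y"
    and nz: "\<phi> x0 y0 \<noteq> 0" and k: "k \<ge> 2"
  shows "\<mu> \<in> sip_eigenvalues c \<beta> k"
proof -
  have "\<exists>\<eta>\<in>configs k. pair_form \<phi> \<eta> \<noteq> 0"
    using pair_form_eq_0D[of \<phi> k x0 y0] \<phi> nz k by blast
  moreover have "- sip_generator c \<beta> (pair_form \<phi>) \<eta> = \<mu> * pair_form \<phi> \<eta>" for \<eta>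
    unfolding sip_generator_pair_form[of c \<phi>, OF c \<phi>] pair_form_def ev
    by (simp add: sum_distrib_left sum_negf mult.assoc)
  ultimately show ?thesis unfolding sip_eigenvalues_def by blast
qed

lemma sip_eigenvalue_walkI:
  fixes c :: "'v::finite \<Rightarrow> 'v \<Rightarrow> real"
  assumes c: "\<And>x y. c x y = c y x"
    and ev: "\<And>x. walk_generator c \<beta> a x = - \<mu> * a x"
    and nz: "a x0 \<noteq> 0" and k: "k \<ge> 1"
  shows "\<mu> \<in> sip_eigenvalues c \<beta> k"
proof -
  have "\<exists>\<eta>\<in>configs k. lin_form a \<eta> \<noteq> 0"
    using nz k by (intro bexI[OF _ condensate_in_configs[of k x0]]) (simp add: lin_form_condensate)
  moreover have "- sip_generator c \<beta> (lin_form a) \<eta> = \<mu> * lin_form a \<eta>" for \<eta>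
    unfolding sip_generator_lin_form[of c, OF c] lin_form_def ev
    by (simp add: sum_distrib_left sum_negf mult.assoc)
  ultimately show ?thesis unfolding sip_eigenvalues_def by blast
qed

text \<open>The configuration with one particle at \<open>x\<close> and one at \<open>y\<close> is written as a condensate of two
  particles at \<open>x\<close> from which one particle has jumped to \<open>y\<close>.\<close>

lemma two_particle_configE:
  fixes \<eta> :: "'v::finite \<Rightarrow> nat"
  assumes "\<eta> \<in> configs 2"
  obtains x y where "\<eta> = move x y (condensate 2 x)"
proof -
  have s: "(\<Sum>z\<in>UNIV. \<eta> z) = 2" using assms by (simp add: configs_def)
  then obtain x where x: "\<eta> x > 0"
    by (metis gr0I sum.neutral zero_neq_numeral)
  have s': "(\<Sum>z\<in>UNIV. \<eta> z - delta x z) = 1"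
  proof -
    have "(\<Sum>z\<in>UNIV. \<eta> z - delta x z) = (\<Sum>z\<in>UNIV. \<eta> z) - (\<Sum>z\<in>UNIV. delta x z)"
      using x by (intro sum_subtractf_nat) (auto simp: delta_def)
    then show ?thesis using s by (simp add: delta_def)
  qed
  then obtain y where y: "\<eta> y - delta x y = 1" "\<And>z. z \<noteq> y \<Longrightarrow> \<eta> z - delta x z = 0"
    using sum_eq_1_iff[of UNIV "\<lambda>z. \<eta> z - delta x z"] by auto
  have "\<eta> z = move x y (condensate 2 x) z" for z
    using y(1) y(2)[of z] x unfolding move_def condensate_def delta_def
    by (cases "z = x"; cases "z = y") (auto split: if_splits)
  then show ?thesis using that by blast
qed

lemma move_condensate_2_commute: "move x y (condensate 2 x) = move y x (condensate 2 y)"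
  by (rule ext) (auto simp: move_def condensate_def delta_def)

text \<open>A function of two unlabelled particles is a symmetric kernel, so the two-particle
  eigenvalues are exactly the eigenvalues of the pair generator on symmetric kernels.\<close>

lemma two_particle_eigenvalueE:
  fixes c :: "'v::finite \<Rightarrow> 'v \<Rightarrow> real"
  assumes c: "\<And>x y. c x y = c y x" "\<And>x. c x x = 0" and \<mu>: "\<mu> \<in> sip_eigenvalues c \<beta> 2"
  obtains \<phi> x0 y0 where "\<And>x y. \<phi> x y = \<phi> y x" "\<phi> x0 y0 \<noteq> 0"
    "\<And>x y. pair_generator c \<beta> \<phi> x y = - \<mu> * \<phi> x y"
proof -
  obtain f where f: "\<exists>\<eta>\<in>configs 2. f \<eta> \<noteq> 0"
      "\<And>\<eta>. \<eta> \<in> configs 2 \<Longrightarrow> - sip_generator c \<beta> f \<eta> = \<mu> * f \<eta>"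
    using \<mu> unfolding sip_eigenvalues_def by blast
  define \<phi> where "\<phi> x y = f (move x y (condensate 2 x))" for x y
  have sym: "\<phi> x y = \<phi> y x" for x y
    unfolding \<phi>_def by (simp only: move_condensate_2_commute)
  have mem: "move x y (condensate 2 x) \<in> configs 2" for x y :: 'v
    by (rule move_in_configs[OF condensate_in_configs]) (simp add: condensate_def)
  have pf: "pair_form \<psi> (move x y (condensate 2 x)) = 2 * \<psi> x y"
    if "\<And>x y. \<psi> x y = \<psi> y x" for \<psi> and x y :: 'v
    using pair_form_move_condensate[of \<psi> 2 x y, OF that] by simp
  have f_eq: "f \<eta> = (1/2) * pair_form \<phi> \<eta>" if "\<eta> \<in> configs 2" for \<eta>
  proof -
    obtain x y where "\<eta> = move x y (condensate 2 x)" using two_particle_configE[OF \<open>\<eta> \<in> configs 2\<close>] by blast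
    then show ?thesis using pf[of \<phi> x y, OF sym] by (simp add: \<phi>_def)
  qed
  have gsym: "pair_generator c \<beta> \<phi> x y = pair_generator c \<beta> \<phi> y x" for x y
    by (simp add: pair_generator_def)
  have "pair_generator c \<beta> \<phi> x y = - \<mu> * \<phi> x y" for x y
  proof -
    let ?\<eta> = "move x y (condensate 2 x)"
    have "sip_generator c \<beta> f ?\<eta> = sip_generator c \<beta> (\<lambda>\<zeta>. (1/2) * pair_form \<phi> \<zeta>) ?\<eta>"
      by (rule sip_generator_cong[OF mem f_eq])
    also have "\<dots> = (1/2) * pair_form (pair_generator c \<beta> \<phi>) ?\<eta>"
      unfolding sip_generator_scale sip_generator_pair_form[of c \<phi>, OF c sym] ..
    also have "\<dots> = pair_generator c \<beta> \<phi> x y"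
      by (simp add: pf[of "pair_generator c \<beta> \<phi>", OF gsym])
    finally show ?thesis using f(2)[OF mem, of x y] by (simp add: \<phi>_def)
  qed
  moreover obtain x0 y0 where "\<phi> x0 y0 \<noteq> 0"
    using f(1) two_particle_configE unfolding \<phi>_def by metis
  ultimately show ?thesis using that sym by blast
qed

text \<open>Summing a two-particle eigenfunction over all pairs of particles yields an eigenfunction
  with the same eigenvalue. This gives one half of the comparison of the gaps.\<close>

lemma sip_eigenvalues_2_subset:
  fixes c :: "'v::finite \<Rightarrow> 'v \<Rightarrow> real"
  assumes c: "\<And>x y. c x y = c y x" "\<And>x. c x x = 0" and k: "k \<ge> 2"
  shows "sip_eigenvalues c \<beta> 2 \<subseteq> sip_eigenvalues c \<beta> k"
proof
  fix \<mu> assume "\<mu> \<in> sip_eigenvalues c \<beta> 2"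
  then obtain \<phi> x0 y0 where "\<And>x y. \<phi> x y = \<phi> y x" "\<phi> x0 y0 \<noteq> 0"
    "\<And>x y. pair_generator c \<beta> \<phi> x y = - \<mu> * \<phi> x y"
    using two_particle_eigenvalueE[of c, OF c] by metis
  then show "\<mu> \<in> sip_eigenvalues c \<beta> k"
    using sip_eigenvalue_pairI[of c \<phi>, OF c] k by blast
qed

section \<open>The spectral gap\<close>

lemma finite_obtains_max:
  fixes h :: "'a \<Rightarrow> real"
  assumes "finite S" "s0 \<in> S"
  obtains s where "s \<in> S" "\<And>t. t \<in> S \<Longrightarrow> h t \<le> h s"
proof -
  have "Max (h ` S) \<in> h ` S" using assms by (intro Max_in) auto
  then obtain s where "s \<in> S" "h s = Max (h ` S)" by auto
  then show ?thesis using that[of s] assms(1) by simp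
qed

lemma sip_eigenvalues_nonneg:
  fixes c :: "'v::finite \<Rightarrow> 'v \<Rightarrow> real"
  assumes "\<And>x y. c x y \<ge> 0" "\<And>x. \<beta> x \<ge> 0" "\<mu> \<in> sip_eigenvalues c \<beta> k"
  shows "\<mu> \<ge> 0"
proof -
  obtain f \<eta>0 where f: "\<eta>0 \<in> configs k" "f \<eta>0 \<noteq> 0"
      "\<And>\<eta>. \<eta> \<in> configs k \<Longrightarrow> - sip_generator c \<beta> f \<eta> = \<mu> * f \<eta>"
    using assms(3) unfolding sip_eigenvalues_def by blast
  obtain \<eta> where \<eta>: "\<eta> \<in> configs k" "\<And>\<zeta>. \<zeta> \<in> configs k \<Longrightarrow> \<bar>f \<zeta>\<bar> \<le> \<bar>f \<eta>\<bar>"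
    using finite_obtains_max[OF finite_configs f(1), of "\<lambda>\<zeta>. \<bar>f \<zeta>\<bar>"] by blast
  define s where "s = sgn (f \<eta>)"
  have pos: "\<bar>f \<eta>\<bar> > 0" using \<eta>(2)[OF f(1)] f(2) by linarith
  have "sip_generator c \<beta> (\<lambda>\<zeta>. s * f \<zeta>) \<eta> \<le> 0"
  proof (rule sip_generator_at_max[OF assms(1,2) \<eta>(1)])
    fix \<zeta> :: "'v \<Rightarrow> nat" assume "\<zeta> \<in> configs k"
    from \<eta>(2)[OF this] show "s * f \<zeta> \<le> s * f \<eta>"
      unfolding s_def by (auto simp: sgn_if)
  qed
  then have "0 \<le> s * (- sip_generator c \<beta> f \<eta>)" by (simp add: sip_generator_scale)
  also have "\<dots> = \<mu> * \<bar>f \<eta>\<bar>" using f(3)[OF \<eta>(1)] by (simp add: s_def sgn_if)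
  finally show ?thesis using pos by (simp add: zero_le_mult_iff)
qed

lemma zero_in_sip_eigenvalues: "0 \<in> sip_eigenvalues c \<beta> k"
  unfolding sip_eigenvalues_def
  by (auto intro!: exI[of _ "\<lambda>_. 1"] bexI[OF _ condensate_in_configs] simp: sip_generator_def)

lemma Min_sip_eigenvalues:
  assumes "\<And>x y. c x y \<ge> 0" "\<And>x. \<beta> x \<ge> 0"
  shows "Min (sip_eigenvalues c \<beta> k) = 0"
  by (intro Min_eqI finite_sip_eigenvalues zero_in_sip_eigenvalues sip_eigenvalues_nonneg[OF assms])

lemma sip_gap_le:
  assumes "\<And>x y. c x y \<ge> 0" "\<And>x. \<beta> x \<ge> 0" "\<mu> \<in> sip_eigenvalues c \<beta> k" "\<mu> \<noteq> 0"
  shows "sip_gap c \<beta> k \<le> \<mu>"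
  unfolding sip_gap_def Min_sip_eigenvalues[OF assms(1,2)]
  using assms(3,4) by (intro Min_le) (auto simp: finite_sip_eigenvalues)

lemma sip_gap_eigenvalue:
  assumes "\<And>x y. c x y \<ge> 0" "\<And>x. \<beta> x \<ge> 0" "\<mu> \<in> sip_eigenvalues c \<beta> k" "\<mu> \<noteq> 0"
  shows "sip_gap c \<beta> k \<in> sip_eigenvalues c \<beta> k" "sip_gap c \<beta> k > 0"
proof -
  have "sip_gap c \<beta> k \<in> sip_eigenvalues c \<beta> k - {0}"
    unfolding sip_gap_def Min_sip_eigenvalues[OF assms(1,2)]
    using assms(3,4) by (intro Min_in) (auto simp: finite_sip_eigenvalues)
  then show "sip_gap c \<beta> k \<in> sip_eigenvalues c \<beta> k" "sip_gap c \<beta> k > 0"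
    using sip_eigenvalues_nonneg[OF assms(1,2), where \<mu> = "sip_gap c \<beta> k" and k = k] by (auto simp: order_less_le)
qed

section \<open>Barriers vanishing on condensates\<close>

lemma sip_generator_diff:
  "sip_generator c \<beta> (\<lambda>\<zeta>. f \<zeta> - g \<zeta>) \<eta> = sip_generator c \<beta> f \<eta> - sip_generator c \<beta> g \<eta>"
  by (simp add: sip_generator_def algebra_simps sum.distrib sum_subtractf)

lemma lin_form_le:
  fixes r :: "'v::finite \<Rightarrow> real"
  assumes "\<eta> \<in> configs k" "\<And>x. r x \<le> b"
  shows "lin_form r \<eta> \<le> b * real k"
proof -
  have "lin_form r \<eta> \<le> (\<Sum>x\<in>UNIV. b * real (\<eta> x))"
    unfolding lin_form_def by (intro sum_mono mult_right_mono assms(2)) auto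
  also have "\<dots> = b * real k"
    using assms(1) by (simp add: configs_def sum_distrib_left[symmetric] flip: of_nat_sum)
  finally show ?thesis .
qed

text \<open>Subtract from an eigenfunction \<open>f\<close> the linear function that agrees with it on the
  condensates. The remainder \<open>w\<close> vanishes on condensates and solves the eigenvalue equation up to a
  linear source \<open>r\<close>. That source is produced by the values of \<open>w\<close> next to the condensates, where \<open>w\<close>
  is at most \<open>M G\<close> with \<open>M\<close> the largest ratio of \<open>\<bar>w\<bar>\<close> to \<open>G\<close>; since the barrier leaks less than
  \<open>\<kappa>\<close> into the condensates, the source is smaller than \<open>M \<kappa>\<close>. But at the point where the ratio is
  largest the maximum principle requires a source of at least \<open>M \<kappa>\<close>. So \<open>M = 0\<close>, the eigenfunction is
  linear, and its eigenvalue belongs to the walk of a single particle.\<close>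

lemma eigenvalue_below_barrier_is_walk_eigenvalue:
  fixes c :: "'v::finite \<Rightarrow> 'v \<Rightarrow> real"
  assumes sym: "\<And>x y. c x y = c y x" and c: "\<And>x y. c x y \<ge> 0" and \<beta>: "\<And>x. \<beta> x \<ge> 0" and k: "k \<ge> 1"
    and G0: "\<And>x. G (condensate k x) = 0"
    and Gpos: "\<And>\<eta>. \<eta> \<in> configs k \<Longrightarrow> \<eta> \<notin> range (condensate k) \<Longrightarrow> G \<eta> > 0"
    and super: "\<And>\<eta>. \<eta> \<in> configs k \<Longrightarrow> \<eta> \<notin> range (condensate k) \<Longrightarrow> sip_generator c \<beta> G \<eta> \<le> - \<mu> * G \<eta> - \<kappa>"
    and leak: "\<And>x. sip_generator c \<beta> G (condensate k x) < \<kappa>"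
    and \<mu>': "\<mu>' \<in> sip_eigenvalues c \<beta> k" "\<mu>' \<le> \<mu>"
  obtains a x0 where "a x0 \<noteq> 0" "\<And>x. walk_generator c \<beta> a x = - \<mu>' * a x"
proof -
  obtain f \<eta>0 where f: "\<eta>0 \<in> configs k" "f \<eta>0 \<noteq> 0"
      "\<And>\<eta>. \<eta> \<in> configs k \<Longrightarrow> - sip_generator c \<beta> f \<eta> = \<mu>' * f \<eta>"
    using \<mu>'(1) unfolding sip_eigenvalues_def by blast
  define a where "a x = f (condensate k x) / real k" for x
  define w where "w \<eta> = f \<eta> - lin_form a \<eta>" for \<eta>
  define r where "r x = walk_generator c \<beta> a x + \<mu>' * a x" for x
  have w0: "w (condensate k x) = 0" for x
    using k by (simp add: w_def a_def lin_form_condensate)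
  have Lw: "sip_generator c \<beta> w \<eta> = - \<mu>' * w \<eta> - lin_form r \<eta>" if "\<eta> \<in> configs k" for \<eta>
  proof -
    have "sip_generator c \<beta> w \<eta> = sip_generator c \<beta> f \<eta> - lin_form (walk_generator c \<beta> a) \<eta>"
      unfolding w_def sip_generator_diff sip_generator_lin_form[of c, OF sym] ..
    also have "lin_form (walk_generator c \<beta> a) \<eta> = lin_form r \<eta> - \<mu>' * lin_form a \<eta>"
      by (simp add: lin_form_def r_def algebra_simps sum.distrib sum_distrib_left)
    finally have "sip_generator c \<beta> w \<eta> = sip_generator c \<beta> f \<eta> - (lin_form r \<eta> - \<mu>' * lin_form a \<eta>)" .
    moreover have "\<mu>' * w \<eta> = \<mu>' * f \<eta> - \<mu>' * lin_form a \<eta>" by (simp add: w_def algebra_simps)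
    ultimately show ?thesis using f(3)[OF that] by linarith
  qed
  have Lw_cond: "sip_generator c \<beta> w (condensate k x) = - (r x * real k)" for x
    by (simp add: Lw condensate_in_configs w0 lin_form_condensate)
  have w_zero: "w \<eta> = 0" if \<eta>: "\<eta> \<in> configs k" for \<eta>
  proof (rule ccontr)
    assume nz: "w \<eta> \<noteq> 0"
    define N :: "('v \<Rightarrow> nat) set" where "N = configs k - range (condensate k)"
    have "finite N" "\<eta> \<in> N" using finite_configs \<eta> nz w0 by (auto simp: N_def)
    then obtain \<xi> where \<xi>: "\<xi> \<in> N" "\<And>\<zeta>. \<zeta> \<in> N \<Longrightarrow> \<bar>w \<zeta>\<bar> / G \<zeta> \<le> \<bar>w \<xi>\<bar> / G \<xi>"
      using finite_obtains_max[of N \<eta> "\<lambda>\<zeta>. \<bar>w \<zeta>\<bar> / G \<zeta>"] by blast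
    define M where "M = \<bar>w \<xi>\<bar> / G \<xi>"
    have GN: "G \<zeta> > 0" if "\<zeta> \<in> N" for \<zeta> using that Gpos by (auto simp: N_def)
    have "0 < \<bar>w \<eta>\<bar> / G \<eta>" using nz GN \<open>\<eta> \<in> N\<close> by simp
    also have "\<dots> \<le> M" unfolding M_def by (rule \<xi>(2)[OF \<open>\<eta> \<in> N\<close>])
    finally have M: "M > 0" .
    have bound: "\<bar>w \<zeta>\<bar> \<le> M * G \<zeta>" if "\<zeta> \<in> configs k" for \<zeta>
    proof (cases "\<zeta> \<in> N")
      case True
      with \<xi>(2)[OF True] GN[OF True] show ?thesis by (simp add: M_def pos_divide_le_eq)
    next
      case False
      with that have "\<zeta> \<in> range (condensate k)" by (simp add: N_def)
      then show ?thesis using w0 G0 by auto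
    qed
    \<comment> \<open>Both signs of \<open>w\<close> lie below \<open>M G\<close>, so the maximum principle applies wherever they touch it.\<close>
    have touch: "s * sip_generator c \<beta> w \<zeta> \<le> M * sip_generator c \<beta> G \<zeta>"
      if "\<zeta> \<in> configs k" "s * w \<zeta> = M * G \<zeta>" "\<bar>s\<bar> \<le> 1" for s \<zeta>
    proof -
      have "sip_generator c \<beta> (\<lambda>\<zeta>. s * w \<zeta> - M * G \<zeta>) \<zeta> \<le> 0"
      proof (rule sip_generator_at_max[OF c \<beta> that(1)])
        fix \<theta> :: "'v \<Rightarrow> nat" assume "\<theta> \<in> configs k"
        have "s * w \<theta> \<le> \<bar>s\<bar> * \<bar>w \<theta>\<bar>" by (metis abs_ge_self abs_mult)
        also have "\<dots> \<le> 1 * \<bar>w \<theta>\<bar>" by (intro mult_right_mono that) auto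
        also have "\<dots> \<le> M * G \<theta>" using bound[OF \<open>\<theta> \<in> configs k\<close>] by simp
        finally show "s * w \<theta> - M * G \<theta> \<le> s * w \<zeta> - M * G \<zeta>" using that(2) by simp
      qed
      then show ?thesis by (simp add: sip_generator_diff sip_generator_scale)
    qed
    have r: "\<bar>r x\<bar> * real k < M * \<kappa>" for x
    proof -
      have "\<bar>r x\<bar> * real k = - sgn (r x) * sip_generator c \<beta> w (condensate k x)"
        by (simp add: Lw_cond sgn_if)
      also have "\<dots> \<le> M * sip_generator c \<beta> G (condensate k x)"
        by (rule touch) (auto simp: condensate_in_configs w0 G0 sgn_if)
      also have "\<dots> < M * \<kappa>" using M leak by simp
      finally show ?thesis .
    qed
    obtain x1 where x1: "\<And>x. \<bar>r x\<bar> \<le> \<bar>r x1\<bar>"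
      using finite_obtains_max[of UNIV undefined "\<lambda>x. \<bar>r x\<bar>"] by auto
    define s where "s = sgn (w \<xi>)"
    have \<xi>': "\<xi> \<in> configs k" "\<xi> \<notin> range (condensate k)" using \<xi>(1) by (auto simp: N_def)
    have sw: "s * w \<xi> = M * G \<xi>" using GN[OF \<xi>(1)] by (simp add: s_def M_def sgn_if)
    have "s * sip_generator c \<beta> w \<xi> \<le> M * sip_generator c \<beta> G \<xi>"
      by (rule touch[OF \<xi>'(1) sw]) (simp add: s_def sgn_if)
    also have "\<dots> \<le> M * (- \<mu> * G \<xi> - \<kappa>)" using M super[OF \<xi>'] by simp
    finally have "s * (- \<mu>' * w \<xi> - lin_form r \<xi>) \<le> - \<mu> * (M * G \<xi>) - M * \<kappa>"
      by (simp add: Lw[OF \<xi>'(1)] algebra_simps)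
    also have "s * (- \<mu>' * w \<xi> - lin_form r \<xi>) = - \<mu>' * (s * w \<xi>) - s * lin_form r \<xi>"
      by (simp add: algebra_simps)
    finally have "M * \<kappa> + (\<mu> - \<mu>') * (M * G \<xi>) \<le> s * lin_form r \<xi>"
      unfolding sw by (simp add: algebra_simps)
    moreover have "0 \<le> (\<mu> - \<mu>') * (M * G \<xi>)"
      using \<mu>'(2) M GN[OF \<xi>(1)] by simp
    moreover have "s * lin_form r \<xi> = lin_form (\<lambda>x. s * r x) \<xi>"
      by (simp add: lin_form_def sum_distrib_left mult.assoc)
    moreover have "lin_form (\<lambda>x. s * r x) \<xi> \<le> \<bar>r x1\<bar> * real k"
    proof (rule lin_form_le[OF \<xi>'(1)])
      fix x show "s * r x \<le> \<bar>r x1\<bar>" using x1[of x] by (auto simp: s_def sgn_if)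
    qed
    ultimately show False using r[of x1] by linarith
  qed
  have "r x = 0" for x
  proof -
    have "sip_generator c \<beta> w (condensate k x) = sip_generator c \<beta> (\<lambda>_. 0) (condensate k x)"
      by (rule sip_generator_cong[OF condensate_in_configs]) (rule w_zero)
    then have "- (r x * real k) = 0" unfolding Lw_cond by (simp add: sip_generator_def)
    then show ?thesis using k by simp
  qed
  then have "walk_generator c \<beta> a x = - \<mu>' * a x" for x
    by (simp add: r_def eq_neg_iff_add_eq_0)
  moreover obtain x0 where "a x0 \<noteq> 0"
  proof (rule ccontr)
    assume "\<not> thesis"
    then have "a x = 0" for x using that by blast
    then have "lin_form a \<eta>0 = 0" by (simp add: lin_form_def)
    then show False using w_zero[OF f(1)] f(2) by (simp add: w_def)
  qed
  ultimately show ?thesis using that by blast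
qed

text \<open>At an empty site the factor that could be negative is multiplied by zero.\<close>

lemma pair_count_nonneg: "real (\<eta> x) * (real (\<eta> y) - of_bool (x = y)) \<ge> 0"
  by (cases "\<eta> x = 0") (auto simp: of_bool_def)

lemma pair_form_mono:
  assumes "\<And>x y. \<phi> x y \<le> \<psi> x y"
  shows "pair_form \<phi> \<eta> \<le> pair_form \<psi> \<eta>"
  unfolding pair_form_def mult.assoc
  by (intro sum_mono mult_right_mono assms pair_count_nonneg)

lemma pair_form_ge_term:
  assumes "\<And>x y. \<phi> x y \<ge> 0" "\<eta> x > 0" "\<eta> y > 0" "x \<noteq> y"
  shows "pair_form \<phi> \<eta> \<ge> \<phi> x y"
proof -
  have "\<phi> x y \<le> \<phi> x y * (real (\<eta> x) * real (\<eta> y))"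
  proof -
    have "1 * 1 \<le> real (\<eta> x) * real (\<eta> y)" using assms(2,3) by (intro mult_mono) auto
    from mult_left_mono[OF this assms(1)] show ?thesis by simp
  qed
  also have "\<dots> = \<phi> x y * (real (\<eta> x) * (real (\<eta> y) - of_bool (x = y)))"
    using assms(4) by simp
  also have "\<dots> \<le> pair_form \<phi> \<eta>"
  proof -
    define h where "h x y = \<phi> x y * (real (\<eta> x) * (real (\<eta> y) - of_bool (x = y)))" for x y
    have h: "h x y \<ge> 0" for x y
      unfolding h_def by (intro mult_nonneg_nonneg[OF assms(1) pair_count_nonneg])
    have "h x y \<le> sum (h x) UNIV" by (rule member_le_sum) (simp_all add: h)
    also have "\<dots> \<le> (\<Sum>x\<in>UNIV. sum (h x) UNIV)"
      by (rule member_le_sum[where f = "\<lambda>x. sum (h x) UNIV"]) (simp_all add: h sum_nonneg)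
    finally show ?thesis by (simp add: h_def pair_form_def mult.assoc)
  qed
  finally show ?thesis .
qed

lemma not_condensateE:
  assumes "\<eta> \<in> configs k" "\<eta> \<notin> range (condensate k)"
  obtains x y where "x \<noteq> y" "\<eta> x > 0" "\<eta> y > 0"
proof (rule ccontr)
  assume neg: "\<not> thesis"
  have s: "(\<Sum>z\<in>UNIV. \<eta> z) = k" using assms(1) by (simp add: configs_def)
  have one: "x = y" if "\<eta> x > 0" "\<eta> y > 0" for x y
    using neg that \<open>\<And>x y. x \<noteq> y \<Longrightarrow> \<eta> x > 0 \<Longrightarrow> \<eta> y > 0 \<Longrightarrow> thesis\<close> by blast
  have "\<exists>x. \<forall>y. y \<noteq> x \<longrightarrow> \<eta> y = 0"
  proof (cases "\<exists>x. \<eta> x > 0")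
    case True
    then obtain x where "\<eta> x > 0" ..
    then show ?thesis using one[of x] by (metis gr0I)
  qed simp
  then obtain x where "\<And>y. y \<noteq> x \<Longrightarrow> \<eta> y = 0" by blast
  then have "(\<Sum>z\<in>UNIV. \<eta> z) = (\<Sum>z\<in>UNIV. if z = x then \<eta> x else 0)"
    by (intro sum.cong refl) auto
  then have "\<eta> x = k" using s by simp
  have "\<eta> = condensate k x"
  proof
    fix z show "\<eta> z = condensate k x z"
      using \<open>\<eta> x = k\<close> \<open>\<And>y. y \<noteq> x \<Longrightarrow> \<eta> y = 0\<close>[of z] by (cases "z = x") (simp_all add: condensate_def)
  qed
  with assms(2) show False by blast
qed

lemma pair_form_coincident_le:
  fixes \<eta> :: "'v::finite \<Rightarrow> nat"
  assumes "\<eta> \<in> configs k"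
  shows "pair_form (\<lambda>x y. of_bool (x = y)) \<eta> \<le> real k * (real k - 1)"
proof -
  have s: "(\<Sum>z\<in>UNIV. real (\<eta> z)) = real k"
    using assms by (simp add: configs_def flip: of_nat_sum)
  have le: "real (\<eta> x) \<le> real k" for x
    unfolding s[symmetric] by (rule member_le_sum) auto
  have "pair_form (\<lambda>x y. of_bool (x = y)) \<eta> = (\<Sum>x\<in>UNIV. real (\<eta> x) * (real (\<eta> x) - 1))"
    unfolding pair_form_def
  proof (intro sum.cong refl)
    fix x
    have "(\<Sum>y\<in>UNIV. of_bool (x = y) * real (\<eta> x) * (real (\<eta> y) - of_bool (x = y)))
       = (\<Sum>y\<in>UNIV. if y = x then real (\<eta> x) * (real (\<eta> x) - 1) else 0)"
      by (intro sum.cong refl) auto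
    then show "(\<Sum>y\<in>UNIV. of_bool (x = y) * real (\<eta> x) * (real (\<eta> y) - of_bool (x = y)))
       = real (\<eta> x) * (real (\<eta> x) - 1)" by simp
  qed
  also have "\<dots> \<le> (\<Sum>x\<in>UNIV. real (\<eta> x) * (real k - 1))"
    using le by (intro sum_mono mult_left_mono) auto
  also have "\<dots> = real k * (real k - 1)" by (simp only: sum_distrib_right[symmetric] s)
  finally show ?thesis .
qed

text \<open>Lifting a two-particle supersolution to all pairs gives a barrier for every number of
  particles at once. Every configuration other than a condensate has two particles at different sites,
  which yields a surplus of at least \<open>\<kappa>\<close>; at most \<open>k (k - 1)\<close> ordered pairs are coincident, and each
  of them spoils the inequality by at most \<open>\<delta>\<close>. The factor two leaves room for the leak into the
  condensates.\<close>

lemma eigenvalue_below_pair_barrier_is_walk_eigenvalue: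
  fixes c \<phi> :: "'v::finite \<Rightarrow> 'v \<Rightarrow> real"
  assumes sym: "\<And>x y. c x y = c y x" and loop: "\<And>x. c x x = 0" and c: "\<And>x y. c x y \<ge> 0"
    and \<beta>: "\<And>x. \<beta> x \<ge> 0" and k: "k \<ge> 1"
    and \<phi>: "\<And>x y. \<phi> x y = \<phi> y x" "\<And>x. \<phi> x x = 0" "\<And>x y. x \<noteq> y \<Longrightarrow> \<phi> x y > 0"
    and super: "\<And>x y. x \<noteq> y \<Longrightarrow> pair_generator c \<beta> \<phi> x y \<le> - \<mu> * \<phi> x y - \<kappa>"
    and leak: "\<And>x. pair_generator c \<beta> \<phi> x x \<le> \<delta>" "\<delta> \<ge> 0" "2 * (real k * (real k - 1)) * \<delta> < \<kappa>"
    and \<mu>': "\<mu>' \<in> sip_eigenvalues c \<beta> k" "\<mu>' \<le> \<mu>"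
  obtains a x0 where "a x0 \<noteq> 0" "\<And>x. walk_generator c \<beta> a x = - \<mu>' * a x"
proof (rule eigenvalue_below_barrier_is_walk_eigenvalue[where G = "pair_form \<phi>"
      and \<kappa> = "\<kappa> - real k * (real k - 1) * \<delta>", OF sym c \<beta> k _ _ _ _ \<mu>'])
  note result = that
  have \<phi>0: "\<phi> x y \<ge> 0" for x y using \<phi>(2,3) by (cases "x = y") (auto intro: less_imp_le)
  have kk: "real k * (real k - 1) \<ge> 0" using k by simp
  have \<kappa>: "\<kappa> > 0" using leak(2,3) mult_nonneg_nonneg[OF kk leak(2)] by linarith
  show "pair_form \<phi> (condensate k x) = 0" for x by (simp add: pair_form_condensate \<phi>)
  show "pair_form \<phi> \<eta> > 0" if \<eta>: "\<eta> \<in> configs k" "\<eta> \<notin> range (condensate k)" for \<eta>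
  proof -
    obtain x y where "x \<noteq> y" "\<eta> x > 0" "\<eta> y > 0" using not_condensateE[OF \<eta>] by blast
    then show ?thesis using pair_form_ge_term[of \<phi> \<eta> x y] \<phi>0 \<phi>(3)[of x y] by force
  qed
  show "sip_generator c \<beta> (pair_form \<phi>) (condensate k x) < \<kappa> - real k * (real k - 1) * \<delta>" for x
    using mult_left_mono[OF leak(1) kk, of x] leak(3)
    unfolding sip_generator_pair_form[of c \<phi>, OF sym loop \<phi>(1)] pair_form_condensate by linarith
  show "sip_generator c \<beta> (pair_form \<phi>) \<eta> \<le> - \<mu> * pair_form \<phi> \<eta> - (\<kappa> - real k * (real k - 1) * \<delta>)"
    if \<eta>: "\<eta> \<in> configs k" "\<eta> \<notin> range (condensate k)" for \<eta>
  proof -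
    obtain x y where xy: "x \<noteq> y" "\<eta> x > 0" "\<eta> y > 0" using not_condensateE[OF \<eta>] by blast
    have "sip_generator c \<beta> (pair_form \<phi>) \<eta> = pair_form (pair_generator c \<beta> \<phi>) \<eta>"
      by (rule sip_generator_pair_form[of c \<phi>, OF sym loop \<phi>(1)])
    also have "\<dots> \<le> pair_form (\<lambda>x y. - \<mu> * \<phi> x y - \<kappa> * of_bool (x \<noteq> y) + \<delta> * of_bool (x = y)) \<eta>"
      by (rule pair_form_mono) (use super leak(1) \<phi>(2) in auto)
    also have "\<dots> = - \<mu> * pair_form \<phi> \<eta> - \<kappa> * pair_form (\<lambda>x y. of_bool (x \<noteq> y)) \<eta>
        + \<delta> * pair_form (\<lambda>x y. of_bool (x = y)) \<eta>"
      unfolding pair_form_def sum_distrib_left sum.distrib[symmetric] sum_subtractf[symmetric]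
      by (intro sum.cong refl) (simp add: left_diff_distrib distrib_right mult.assoc)
    also have "\<dots> \<le> - \<mu> * pair_form \<phi> \<eta> - \<kappa> * 1 + \<delta> * (real k * (real k - 1))"
    proof -
      have "1 \<le> pair_form (\<lambda>x y. of_bool (x \<noteq> y)) \<eta>"
        using pair_form_ge_term[of "\<lambda>x y. of_bool (x \<noteq> y)" \<eta> x y] xy by simp
      with \<kappa> have "\<kappa> * 1 \<le> \<kappa> * pair_form (\<lambda>x y. of_bool (x \<noteq> y)) \<eta>"
        by (intro mult_left_mono) auto
      with mult_left_mono[OF pair_form_coincident_le[OF \<eta>(1)] leak(2)] show ?thesis by linarith
    qed
    finally show ?thesis by (simp add: algebra_simps)
  qed
  show thesis if "a x0 \<noteq> 0" "\<And>x. walk_generator c \<beta> a x = - \<mu>' * a x" for a x0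
    by (rule result[of a x0]) (use that in simp_all)
qed

section \<open>Minimisers of Rayleigh quotients\<close>

text \<open>The quotient is homogeneous of degree zero and continuous on the compact unit sphere of
  the subspace.\<close>

lemma rayleigh_minimiser:
  fixes D M :: "'a::euclidean_space \<Rightarrow> 'a \<Rightarrow> real"
  assumes D: "bilinear D" and M: "bilinear M" and U: "subspace U"
    and pos: "\<And>x. x \<in> U \<Longrightarrow> x \<noteq> 0 \<Longrightarrow> M x x > 0"
    and x0: "x0 \<in> U" "x0 \<noteq> 0"
  obtains v \<mu> where "v \<in> U" "v \<noteq> 0" "D v v = \<mu> * M v v" "\<And>x. x \<in> U \<Longrightarrow> D x x \<ge> \<mu> * M x x"
proof -
  define K where "K = U \<inter> sphere 0 1"
  have "compact K" unfolding K_def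
    by (intro closed_Int_compact closed_subspace U) simp
  moreover have "K \<noteq> {}"
  proof -
    have "(1 / norm x0) *\<^sub>R x0 \<in> K" using x0 U by (simp add: K_def subspace_scale)
    then show ?thesis by blast
  qed
  moreover have "continuous_on K (\<lambda>x. D x x / M x x)"
  proof (intro continuous_on_divide bilinear_continuous_on_compose[OF _ _ D] bilinear_continuous_on_compose[OF _ _ M])
    show "\<forall>x\<in>K. M x x \<noteq> 0" using pos by (force simp: K_def)
  qed (rule continuous_on_id)+
  ultimately obtain v where v: "v \<in> K" "\<And>x. x \<in> K \<Longrightarrow> D v v / M v v \<le> D x x / M x x"
    using continuous_attains_inf[of K "\<lambda>x. D x x / M x x"] by blast
  define \<mu> where "\<mu> = D v v / M v v"
  have vU: "v \<in> U" "v \<noteq> 0" using v(1) by (auto simp: K_def)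
  have "D x x \<ge> \<mu> * M x x" if "x \<in> U" for x
  proof (cases "x = 0")
    case True
    then show ?thesis using bilinear_lzero[OF D] bilinear_lzero[OF M] by simp
  next
    case False
    define r where "r = 1 / norm x"
    have r: "r > 0" "r *\<^sub>R x \<in> K"
      using False U that by (auto simp: r_def K_def subspace_scale)
    have "\<mu> \<le> D (r *\<^sub>R x) (r *\<^sub>R x) / M (r *\<^sub>R x) (r *\<^sub>R x)"
      unfolding \<mu>_def by (rule v(2)[OF r(2)])
    also have "\<dots> = D x x / M x x"
      using r(1) by (simp add: bilinear_lmul[OF D] bilinear_rmul[OF D] bilinear_lmul[OF M] bilinear_rmul[OF M])
    finally show ?thesis using pos[OF that False] by (simp add: pos_le_divide_eq)
  qed
  moreover have "D v v = \<mu> * M v v" using pos[OF vU] by (simp add: \<mu>_def)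
  ultimately show ?thesis using that vU by blast
qed

text \<open>The form \<open>D - \<mu> M\<close> is non-negative on the subspace and vanishes at \<open>v\<close>, so its first
  variation at \<open>v\<close> vanishes as well. Stating this for an arbitrary minimiser, and not for the
  one constructed above, allows it to be replaced by its absolute value.\<close>

lemma rayleigh_stationary:
  fixes D M :: "'a::euclidean_space \<Rightarrow> 'a \<Rightarrow> real"
  assumes D: "bilinear D" "\<And>x y. D x y = D y x" and M: "bilinear M" "\<And>x y. M x y = M y x"
    and U: "subspace U" and v: "v \<in> U" "D v v = \<mu> * M v v"
    and min: "\<And>x. x \<in> U \<Longrightarrow> D x x \<ge> \<mu> * M x x" and y: "y \<in> U"
  shows "D v y = \<mu> * M v y"
proof -
  define b where "b = D v y - \<mu> * M v y"
  define e where "e = D y y - \<mu> * M y y"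
  have e: "e \<ge> 0" using min[OF y] by (simp add: e_def)
  have exp: "2 * t * b + t^2 * e \<ge> 0" for t
  proof -
    have "v + t *\<^sub>R y \<in> U" using U v(1) y by (simp add: subspace_add subspace_scale)
    from min[OF this] have "0 \<le> D (v + t *\<^sub>R y) (v + t *\<^sub>R y) - \<mu> * M (v + t *\<^sub>R y) (v + t *\<^sub>R y)" by simp
    also have "\<dots> = 2 * t * b + t^2 * e"
      using v(2) D(2)[of y v] M(2)[of y v]
      by (simp add: bilinear_ladd[OF D(1)] bilinear_radd[OF D(1)] bilinear_lmul[OF D(1)] bilinear_rmul[OF D(1)]
          bilinear_ladd[OF M(1)] bilinear_radd[OF M(1)] bilinear_lmul[OF M(1)] bilinear_rmul[OF M(1)]
          b_def e_def algebra_simps power2_eq_square)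
    finally show ?thesis .
  qed
  define t where "t = - b / (e + 1)"
  have b: "b = - (t * (e + 1))" using e by (simp add: t_def)
  have "2 * t * b + t^2 * e = - (t^2 * (e + 2))"
    unfolding b by (simp add: algebra_simps power2_eq_square)
  with exp[of t] have "t^2 * (e + 2) \<le> 0" by linarith
  with e have "t = 0" by (simp add: mult_le_0_iff)
  then have "b = 0" by (simp add: b)
  then show ?thesis by (simp add: b_def)
qed

section \<open>Dirichlet forms on kernels\<close>

definition kernel_inner :: "('v::finite \<Rightarrow> 'v \<Rightarrow> real) \<Rightarrow> ('v \<Rightarrow> 'v \<Rightarrow> real) \<Rightarrow> ('v \<Rightarrow> 'v \<Rightarrow> real) \<Rightarrow> real" where
  "kernel_inner w \<phi> \<psi> = (\<Sum>x\<in>UNIV. \<Sum>y\<in>UNIV. w x y * \<phi> x y * \<psi> x y)"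

text \<open>Dirichlet form of a motion of the first coordinate, with \<open>K x u y\<close> the conductance between
  \<open>(x, y)\<close> and \<open>(u, y)\<close>. For symmetric kernels the motion of the second coordinate contributes the same
  amount; this is accounted for by omitting the usual factor one half.\<close>

definition kernel_energy ::
  "('v::finite \<Rightarrow> 'v \<Rightarrow> 'v \<Rightarrow> real) \<Rightarrow> ('v \<Rightarrow> 'v \<Rightarrow> real) \<Rightarrow> ('v \<Rightarrow> 'v \<Rightarrow> real) \<Rightarrow> real" where
  "kernel_energy K \<phi> \<psi> =
     (\<Sum>x\<in>UNIV. \<Sum>u\<in>UNIV. \<Sum>y\<in>UNIV. K x u y * (\<phi> u y - \<phi> x y) * (\<psi> u y - \<psi> x y))"

text \<open>Kernels are transported to a Euclidean space, in which compactness of the unit sphere is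
  available.\<close>

definition kernel_of :: "real^'v^'v \<Rightarrow> 'v::finite \<Rightarrow> 'v \<Rightarrow> real" where
  "kernel_of v x y = vec_nth (vec_nth v x) y"

definition vec_of :: "('v::finite \<Rightarrow> 'v \<Rightarrow> real) \<Rightarrow> real^'v^'v" where
  "vec_of \<phi> = (\<chi> x y. \<phi> x y)"

lemma kernel_of_vec_of [simp]: "kernel_of (vec_of \<phi>) = \<phi>"
  by (simp add: kernel_of_def vec_of_def fun_eq_iff)

lemma kernel_of_linear [simp]:
  "kernel_of (u + v) x y = kernel_of u x y + kernel_of v x y"
  "kernel_of (r *\<^sub>R u) x y = r * kernel_of u x y"
  "kernel_of 0 x y = 0"
  by (simp_all add: kernel_of_def)

lemma kernel_of_eq_0_iff: "v = 0 \<longleftrightarrow> (\<forall>x y. kernel_of v x y = 0)"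
  by (simp add: kernel_of_def Finite_Cartesian_Product.vec_eq_iff)

lemma kernel_inner_commute: "kernel_inner w \<phi> \<psi> = kernel_inner w \<psi> \<phi>"
  by (simp add: kernel_inner_def mult_ac)

lemma kernel_energy_commute: "kernel_energy K \<phi> \<psi> = kernel_energy K \<psi> \<phi>"
  by (simp add: kernel_energy_def mult_ac)

lemma bilinear_kernel_inner: "bilinear (\<lambda>u v. kernel_inner w (kernel_of u) (kernel_of v))"
  unfolding bilinear_def kernel_inner_def
  by (auto intro!: linearI simp: algebra_simps sum.distrib sum_distrib_left)

lemma bilinear_kernel_energy: "bilinear (\<lambda>u v. kernel_energy K (kernel_of u) (kernel_of v))"
  unfolding bilinear_def kernel_energy_def
  by (auto intro!: linearI simp: algebra_simps sum.distrib sum_distrib_left sum_subtractf)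

lemma weighted_square_nonneg: "0 \<le> a \<Longrightarrow> 0 \<le> a * (b * b)" for a b :: real
  by simp

lemma kernel_inner_nonneg:
  assumes "\<And>x y. w x y \<ge> 0"
  shows "kernel_inner w \<phi> \<phi> \<ge> 0"
  unfolding kernel_inner_def mult.assoc by (intro sum_nonneg weighted_square_nonneg assms)

lemma sum2_eq_0D:
  fixes h :: "'v::finite \<Rightarrow> 'v \<Rightarrow> real"
  assumes "\<And>x y. h x y \<ge> 0" "(\<Sum>x\<in>UNIV. \<Sum>y\<in>UNIV. h x y) = 0"
  shows "h x y = 0"
proof -
  have "(\<Sum>y\<in>UNIV. h x y) = 0"
    using assms(2) by (subst (asm) sum_nonneg_eq_0_iff) (auto intro: sum_nonneg assms(1))
  then show ?thesis by (subst (asm) sum_nonneg_eq_0_iff) (auto intro: assms(1))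
qed

lemma kernel_inner_eq_0D:
  assumes "\<And>x y. w x y > 0" "kernel_inner w \<phi> \<phi> = 0"
  shows "\<phi> x y = 0"
proof -
  have "w x y * (\<phi> x y * \<phi> x y) = 0"
    using assms(2) unfolding kernel_inner_def mult.assoc
    by (intro sum2_eq_0D[of "\<lambda>x y. w x y * (\<phi> x y * \<phi> x y)"] weighted_square_nonneg less_imp_le[OF assms(1)])
  then show ?thesis using assms(1)[of x y] by simp
qed

lemma kernel_energy_eq_0D:
  assumes K: "\<And>x u y. K x u y \<ge> 0" and "kernel_energy K \<phi> \<phi> = 0" "K x u y > 0"
  shows "\<phi> u y = \<phi> x y"
proof -
  let ?h = "\<lambda>x u y. K x u y * ((\<phi> u y - \<phi> x y) * (\<phi> u y - \<phi> x y))"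
  have h: "?h x u y \<ge> 0" for x u y by (intro weighted_square_nonneg K)
  have "(\<Sum>y\<in>UNIV. ?h x u y) = 0"
    using assms(2) unfolding kernel_energy_def mult.assoc
    by (intro sum2_eq_0D[of "\<lambda>x u. \<Sum>y\<in>UNIV. ?h x u y"] sum_nonneg h)
  then have "?h x u y = 0" by (subst (asm) sum_nonneg_eq_0_iff) (auto intro: h)
  then show ?thesis using assms(3) by simp
qed

lemma kernel_energy_shift: "kernel_energy K \<phi> (\<lambda>x y. \<psi> x y - m) = kernel_energy K \<phi> \<psi>"
  by (simp add: kernel_energy_def)

text \<open>Centring a kernel: the second identity is the formula for the variance with respect to
  the weight \<open>w\<close>, of total mass \<open>Z\<close>.\<close>

lemma kernel_inner_shift:
  assumes Z: "Z = (\<Sum>x\<in>UNIV. \<Sum>y\<in>UNIV. w x y)" "Z \<noteq> 0"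
    and m: "m = kernel_inner w (\<lambda>_ _. 1) \<phi> / Z"
  shows "kernel_inner w (\<lambda>_ _. 1) (\<lambda>x y. \<phi> x y - m) = 0"
    and "kernel_inner w (\<lambda>x y. \<phi> x y - m) (\<lambda>x y. \<phi> x y - m)
        = kernel_inner w \<phi> \<phi> - (kernel_inner w (\<lambda>_ _. 1) \<phi>)\<^sup>2 / Z"
proof -
  let ?s = "kernel_inner w (\<lambda>_ _. 1) \<phi>"
  have "kernel_inner w (\<lambda>_ _. 1) (\<lambda>x y. \<phi> x y - m) = ?s - m * Z"
    by (simp add: kernel_inner_def Z(1) algebra_simps sum_subtractf sum_distrib_left)
  then show "kernel_inner w (\<lambda>_ _. 1) (\<lambda>x y. \<phi> x y - m) = 0" using Z(2) by (simp add: m)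
  have "kernel_inner w (\<lambda>x y. \<phi> x y - m) (\<lambda>x y. \<phi> x y - m) = kernel_inner w \<phi> \<phi> - 2 * m * ?s + m^2 * Z"
    by (simp add: kernel_inner_def Z(1) algebra_simps sum_subtractf sum.distrib sum_distrib_left power2_eq_square)
  also have "\<dots> = kernel_inner w \<phi> \<phi> - ?s\<^sup>2 / Z" using Z(2) by (simp add: m field_simps power2_eq_square)
  finally show "kernel_inner w (\<lambda>x y. \<phi> x y - m) (\<lambda>x y. \<phi> x y - m) = kernel_inner w \<phi> \<phi> - ?s\<^sup>2 / Z" .
qed

lemma kernel_energy_by_parts:
  assumes K: "\<And>x u y. K x u y = K u x y"
  shows "2 * (\<Sum>x\<in>UNIV. \<Sum>y\<in>UNIV. \<psi> x y * (\<Sum>u\<in>UNIV. K x u y * (\<phi> u y - \<phi> x y))) = - kernel_energy K \<phi> \<psi>"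
proof -
  let ?t = "\<lambda>x u y. K x u y * (\<phi> u y - \<phi> x y)"
  define A where "A = (\<Sum>x\<in>UNIV. \<Sum>y\<in>UNIV. \<psi> x y * (\<Sum>u\<in>UNIV. ?t x u y))"
  have A1: "A = (\<Sum>x\<in>UNIV. \<Sum>u\<in>UNIV. \<Sum>y\<in>UNIV. \<psi> x y * ?t x u y)"
    unfolding A_def sum_distrib_left by (intro sum.cong refl sum.swap)
  also have "\<dots> = (\<Sum>u\<in>UNIV. \<Sum>x\<in>UNIV. \<Sum>y\<in>UNIV. \<psi> x y * ?t x u y)" by (rule sum.swap)
  finally have A2: "A = (\<Sum>x\<in>UNIV. \<Sum>u\<in>UNIV. \<Sum>y\<in>UNIV. \<psi> u y * ?t u x y)" .
  have "2 * A = (\<Sum>x\<in>UNIV. \<Sum>u\<in>UNIV. \<Sum>y\<in>UNIV. \<psi> x y * ?t x u y + \<psi> u y * ?t u x y)"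
    using A1 A2 by (simp only: sum.distrib)
  also have "\<dots> = - kernel_energy K \<phi> \<psi>"
    unfolding kernel_energy_def sum_negf[symmetric]
  proof (intro sum.cong refl)
    fix x u y
    show "\<psi> x y * ?t x u y + \<psi> u y * ?t u x y = - (K x u y * (\<phi> u y - \<phi> x y) * (\<psi> u y - \<psi> x y))"
      unfolding K[of u x y] by (simp add: algebra_simps)
  qed
  finally show ?thesis unfolding A_def .
qed

lemma kernel_energy_abs:
  assumes "\<And>x u y. K x u y \<ge> 0"
  shows "kernel_energy K (\<lambda>x y. \<bar>\<phi> x y\<bar>) (\<lambda>x y. \<bar>\<phi> x y\<bar>) \<le> kernel_energy K \<phi> \<phi>"
  unfolding kernel_energy_def mult.assoc
proof (intro sum_mono mult_left_mono assms)
  fix x u y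
  have "\<bar>\<bar>\<phi> u y\<bar> - \<bar>\<phi> x y\<bar>\<bar> \<le> \<bar>\<phi> u y - \<phi> x y\<bar>" by (rule abs_triangle_ineq3)
  then show "(\<bar>\<phi> u y\<bar> - \<bar>\<phi> x y\<bar>) * (\<bar>\<phi> u y\<bar> - \<bar>\<phi> x y\<bar>) \<le> (\<phi> u y - \<phi> x y) * (\<phi> u y - \<phi> x y)"
    by (metis abs_le_square_iff power2_eq_square)
qed

lemma sum2_swap_symmetric:
  fixes h :: "'v::finite \<Rightarrow> 'v \<Rightarrow> real"
  assumes "\<And>x y. \<psi> x y = \<psi> y x"
  shows "(\<Sum>x\<in>UNIV. \<Sum>y\<in>UNIV. \<psi> x y * (h x y + h y x)) = 2 * (\<Sum>x\<in>UNIV. \<Sum>y\<in>UNIV. \<psi> x y * h x y)"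
proof -
  have "(\<Sum>x\<in>UNIV. \<Sum>y\<in>UNIV. \<psi> x y * h y x) = (\<Sum>y\<in>UNIV. \<Sum>x\<in>UNIV. \<psi> x y * h y x)" by (rule sum.swap)
  also have "\<dots> = (\<Sum>y\<in>UNIV. \<Sum>x\<in>UNIV. \<psi> y x * h y x)"
    by (intro sum.cong refl) (simp only: assms[of _ y for y])
  finally show ?thesis by (simp add: distrib_left sum.distrib)
qed

section \<open>Reversibility of the two-particle processes\<close>

text \<open>Two independent walks, acting on symmetric kernels.\<close>

definition walk_pair_generator ::
  "('v::finite \<Rightarrow> 'v \<Rightarrow> real) \<Rightarrow> ('v \<Rightarrow> real) \<Rightarrow> ('v \<Rightarrow> 'v \<Rightarrow> real) \<Rightarrow> 'v \<Rightarrow> 'v \<Rightarrow> real" where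
  "walk_pair_generator c \<beta> \<phi> x y
     = walk_generator c \<beta> (\<lambda>u. \<phi> u y) x + walk_generator c \<beta> (\<lambda>u. \<phi> u x) y"

text \<open>The attraction acts on a pair only when the two particles are adjacent, and then it brings
  them together.\<close>

lemma pair_generator_split:
  "pair_generator c \<beta> \<phi> x y
    = walk_pair_generator c \<beta> \<phi> x y + c x y * (\<phi> y y - \<phi> x y) + c y x * (\<phi> x x - \<phi> y x)"
  by (simp add: pair_generator_def jump_generator_split walk_pair_generator_def walk_generator_def)

text \<open>Up to normalisation the reversible weight of two labelled particles in the inclusion
  process.\<close>

definition pair_weight :: "('v \<Rightarrow> real) \<Rightarrow> 'v \<Rightarrow> 'v \<Rightarrow> real" where
  "pair_weight \<beta> x y = \<beta> y * (\<beta> x + of_bool (x = y))"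

definition pair_conductance :: "('v \<Rightarrow> 'v \<Rightarrow> real) \<Rightarrow> ('v \<Rightarrow> real) \<Rightarrow> 'v \<Rightarrow> 'v \<Rightarrow> 'v \<Rightarrow> real" where
  "pair_conductance c \<beta> x u y = c x u * \<beta> y * (\<beta> x + of_bool (x = y)) * (\<beta> u + of_bool (u = y))"

definition walk_pair_weight :: "('v \<Rightarrow> real) \<Rightarrow> 'v \<Rightarrow> 'v \<Rightarrow> real" where
  "walk_pair_weight \<beta> x y = \<beta> x * \<beta> y"

definition walk_pair_conductance :: "('v \<Rightarrow> 'v \<Rightarrow> real) \<Rightarrow> ('v \<Rightarrow> real) \<Rightarrow> 'v \<Rightarrow> 'v \<Rightarrow> 'v \<Rightarrow> real" where
  "walk_pair_conductance c \<beta> x u y = c x u * \<beta> x * \<beta> u * \<beta> y"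

lemma pair_weight_commute: "pair_weight \<beta> x y = pair_weight \<beta> y x"
  by (auto simp: pair_weight_def)

text \<open>Detailed balance: \<open>pair_conductance\<close> is \<open>pair_weight\<close> times the jump rate, and it is
  symmetric in the two end points of the jump.\<close>

lemma pair_generator_energy:
  fixes c \<psi> :: "'v::finite \<Rightarrow> 'v \<Rightarrow> real"
  assumes c: "\<And>x y. c x y = c y x" and \<psi>: "\<And>x y. \<psi> x y = \<psi> y x"
  shows "kernel_inner (pair_weight \<beta>) \<psi> (pair_generator c \<beta> \<phi>) = - kernel_energy (pair_conductance c \<beta>) \<phi> \<psi>"
proof -
  have "kernel_inner (pair_weight \<beta>) \<psi> (pair_generator c \<beta> \<phi>)
      = 2 * (\<Sum>x\<in>UNIV. \<Sum>y\<in>UNIV. pair_weight \<beta> x y * \<psi> x y * jump_generator c \<beta> \<phi> x y)"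
    unfolding kernel_inner_def pair_generator_def
    by (rule sum2_swap_symmetric) (use \<psi> pair_weight_commute in metis)
  also have "\<dots> = 2 * (\<Sum>x\<in>UNIV. \<Sum>y\<in>UNIV. \<psi> x y * (\<Sum>u\<in>UNIV. pair_conductance c \<beta> x u y * (\<phi> u y - \<phi> x y)))"
    unfolding jump_generator_def sum_distrib_left
    by (intro sum.cong refl) (simp add: pair_weight_def pair_conductance_def)
  also have "\<dots> = - kernel_energy (pair_conductance c \<beta>) \<phi> \<psi>"
    by (rule kernel_energy_by_parts) (use c in \<open>simp add: pair_conductance_def mult_ac\<close>)
  finally show ?thesis .
qed

lemma walk_pair_generator_energy:
  fixes c \<psi> :: "'v::finite \<Rightarrow> 'v \<Rightarrow> real"
  assumes c: "\<And>x y. c x y = c y x" and \<psi>: "\<And>x y. \<psi> x y = \<psi> y x"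
  shows "kernel_inner (walk_pair_weight \<beta>) \<psi> (walk_pair_generator c \<beta> \<phi>)
    = - kernel_energy (walk_pair_conductance c \<beta>) \<phi> \<psi>"
proof -
  have "kernel_inner (walk_pair_weight \<beta>) \<psi> (walk_pair_generator c \<beta> \<phi>)
      = 2 * (\<Sum>x\<in>UNIV. \<Sum>y\<in>UNIV. walk_pair_weight \<beta> x y * \<psi> x y * walk_generator c \<beta> (\<lambda>u. \<phi> u y) x)"
    unfolding kernel_inner_def walk_pair_generator_def
    by (rule sum2_swap_symmetric[where h = "\<lambda>x y. walk_generator c \<beta> (\<lambda>u. \<phi> u y) x"])
       (use \<psi> in \<open>simp add: walk_pair_weight_def mult_ac\<close>)
  also have "\<dots> = 2 * (\<Sum>x\<in>UNIV. \<Sum>y\<in>UNIV. \<psi> x y * (\<Sum>u\<in>UNIV. walk_pair_conductance c \<beta> x u y * (\<phi> u y - \<phi> x y)))"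
    unfolding walk_generator_def sum_distrib_left
    by (intro sum.cong refl) (simp add: walk_pair_weight_def walk_pair_conductance_def)
  also have "\<dots> = - kernel_energy (walk_pair_conductance c \<beta>) \<phi> \<psi>"
    by (rule kernel_energy_by_parts) (use c in \<open>simp add: walk_pair_conductance_def mult_ac\<close>)
  finally show ?thesis .
qed

lemma symmetric_pair_generator:
  "pair_generator c \<beta> \<phi> x y = pair_generator c \<beta> \<phi> y x"
  by (simp add: pair_generator_def)

lemma symmetric_walk_pair_generator:
  "walk_pair_generator c \<beta> \<phi> x y = walk_pair_generator c \<beta> \<phi> y x"
  by (simp add: walk_pair_generator_def)

lemma two_vertices:
  assumes "CARD('v::finite) \<ge> 2"
  shows "\<exists>p q :: 'v. p \<noteq> q"
  using assms by (metis card_2_iff' card_le_Suc0_iff_eq finite not_less_eq_eq numeral_2_eq_2 UNIV_I)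

text \<open>The minimiser of the Rayleigh quotient over the centred symmetric kernels solves the
  eigenvalue equation, since the equation tested against constants is trivial. Its eigenvalue is not
  zero: a kernel without energy is constant in the first argument by connectedness, hence constant by
  symmetry, hence zero because it is centred. The resulting inequality provides upper bounds for the
  two-particle gap by means of test kernels.\<close>

lemma two_particle_spectral_bound:
  fixes c :: "'v::finite \<Rightarrow> 'v \<Rightarrow> real"
  assumes graph: "connected_weighted_graph c" and \<beta>: "\<And>x. \<beta> x > 0"
  obtains \<mu> where "\<mu> \<in> sip_eigenvalues c \<beta> 2" "\<mu> > 0"
    "\<And>\<phi>. (\<And>x y. \<phi> x y = \<phi> y x) \<Longrightarrow>
       \<mu> * (kernel_inner (pair_weight \<beta>) \<phi> \<phi> - (kernel_inner (pair_weight \<beta>) (\<lambda>_ _. 1) \<phi>)\<^sup>2 /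
              (\<Sum>x\<in>UNIV. \<Sum>y\<in>UNIV. pair_weight \<beta> x y))
       \<le> kernel_energy (pair_conductance c \<beta>) \<phi> \<phi>"
proof -
  have sym: "\<And>x y. c x y = c y x" and c: "\<And>x y. c x y \<ge> 0" and loop: "\<And>x. c x x = 0"
    and conn: "\<And>x y. (\<lambda>u v. c u v > 0)\<^sup>*\<^sup>* x y" and two: "CARD('v) \<ge> 2"
    using graph unfolding connected_weighted_graph_def by blast+
  let ?w = "pair_weight \<beta>" and ?K = "pair_conductance c \<beta>"
  define Z where "Z = (\<Sum>x\<in>UNIV. \<Sum>y\<in>UNIV. ?w x y)"
  have w: "?w x y > 0" for x y
    unfolding pair_weight_def using \<beta> by (intro mult_pos_pos add_pos_nonneg) auto
  have K: "?K x u y \<ge> 0" for x u y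
    unfolding pair_conductance_def using \<beta> c
    by (intro mult_nonneg_nonneg add_nonneg_nonneg) (auto intro: less_imp_le)
  have Z: "Z > 0" unfolding Z_def by (intro sum_pos w) auto
  define U where "U = {v. (\<forall>x y. kernel_of v x y = kernel_of v y x) \<and> kernel_inner ?w (\<lambda>_ _. 1) (kernel_of v) = 0}"
  have U: "subspace U"
    unfolding real_vector.subspace_def U_def
    by (auto simp: kernel_inner_def distrib_left sum.distrib sum_distrib_left[symmetric] mult.left_commute)
  let ?m = "\<lambda>\<phi>. kernel_inner ?w (\<lambda>_ _. 1) \<phi> / Z"
  have centred: "vec_of (\<lambda>x y. \<phi> x y - ?m \<phi>) \<in> U" if "\<And>x y. \<phi> x y = \<phi> y x" for \<phi>
    using that kernel_inner_shift(1)[OF Z_def _ refl, of \<phi>] Z by (auto simp: U_def)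
  obtain p q :: 'v where pq: "p \<noteq> q" using two_vertices[OF two] by blast
  define \<phi>0 :: "'v \<Rightarrow> 'v \<Rightarrow> real" where "\<phi>0 x y = of_bool (x = p \<and> y = p)" for x y
  have "kernel_of (vec_of (\<lambda>x y. \<phi>0 x y - ?m \<phi>0)) p p \<noteq> 0 \<or> kernel_of (vec_of (\<lambda>x y. \<phi>0 x y - ?m \<phi>0)) q q \<noteq> 0"
    using pq by (auto simp: \<phi>0_def)
  then have nz: "vec_of (\<lambda>x y. \<phi>0 x y - ?m \<phi>0) \<noteq> 0"
    unfolding kernel_of_eq_0_iff by blast
  have U0: "vec_of (\<lambda>x y. \<phi>0 x y - ?m \<phi>0) \<in> U"
    by (rule centred) (auto simp: \<phi>0_def)
  have pos: "kernel_inner ?w (kernel_of v) (kernel_of v) > 0" if "v \<noteq> 0" for v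
  proof -
    have "kernel_inner ?w (kernel_of v) (kernel_of v) \<noteq> 0"
      using that kernel_inner_eq_0D[of ?w, OF w] unfolding kernel_of_eq_0_iff by blast
    moreover have "kernel_inner ?w (kernel_of v) (kernel_of v) \<ge> 0"
      by (intro kernel_inner_nonneg less_imp_le[OF w])
    ultimately show ?thesis by linarith
  qed
  obtain v \<mu> where v: "v \<in> U" "v \<noteq> 0"
      "kernel_energy ?K (kernel_of v) (kernel_of v) = \<mu> * kernel_inner ?w (kernel_of v) (kernel_of v)"
    and min: "\<And>x. x \<in> U \<Longrightarrow> kernel_energy ?K (kernel_of x) (kernel_of x) \<ge> \<mu> * kernel_inner ?w (kernel_of x) (kernel_of x)"
    using rayleigh_minimiser[OF bilinear_kernel_energy bilinear_kernel_inner U pos U0 nz, of ?K] by blast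
  define \<phi> where "\<phi> = kernel_of v"
  have \<phi>: "\<phi> x y = \<phi> y x" "kernel_inner ?w (\<lambda>_ _. 1) \<phi> = 0" for x y
    using v(1) by (auto simp: U_def \<phi>_def)
  have stat: "kernel_energy ?K \<phi> \<psi> = \<mu> * kernel_inner ?w \<phi> \<psi>" if \<psi>: "\<And>x y. \<psi> x y = \<psi> y x" for \<psi>
  proof -
    have "kernel_energy ?K \<phi> (\<lambda>x y. \<psi> x y - ?m \<psi>) = \<mu> * kernel_inner ?w \<phi> (\<lambda>x y. \<psi> x y - ?m \<psi>)"
      using rayleigh_stationary[OF bilinear_kernel_energy kernel_energy_commute bilinear_kernel_inner
          kernel_inner_commute U v(1,3) min centred[of \<psi>, OF \<psi>]] by (simp add: \<phi>_def)
    moreover have "kernel_inner ?w \<phi> (\<lambda>x y. \<psi> x y - m) = kernel_inner ?w \<phi> \<psi> - m * kernel_inner ?w (\<lambda>_ _. 1) \<phi>" for m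
      by (simp add: kernel_inner_def right_diff_distrib sum_subtractf sum_distrib_left mult_ac)
    ultimately show ?thesis using \<phi>(2) by (simp add: kernel_energy_shift)
  qed
  have ev: "pair_generator c \<beta> \<phi> x y = - \<mu> * \<phi> x y" for x y
  proof -
    define \<rho> where "\<rho> x y = pair_generator c \<beta> \<phi> x y + \<mu> * \<phi> x y" for x y
    have \<rho>: "\<rho> x y = \<rho> y x" for x y
      using \<phi>(1)[of x y] symmetric_pair_generator[of c \<beta> \<phi> x y] by (simp add: \<rho>_def)
    have "kernel_inner ?w \<rho> \<rho> = kernel_inner ?w \<rho> (pair_generator c \<beta> \<phi>) + \<mu> * kernel_inner ?w \<phi> \<rho>"
      unfolding kernel_inner_def sum_distrib_left sum.distrib[symmetric]
      by (intro sum.cong refl) (simp add: \<rho>_def algebra_simps)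
    also have "\<dots> = 0"
      unfolding pair_generator_energy[of c \<rho>, OF sym \<rho>] stat[OF \<rho>] by simp
    finally have "\<rho> x y = 0" using kernel_inner_eq_0D[of ?w, OF w] by blast
    then show ?thesis by (simp add: \<rho>_def eq_neg_iff_add_eq_0)
  qed
  obtain x1 y1 where nz1: "\<phi> x1 y1 \<noteq> 0" using v(2) unfolding kernel_of_eq_0_iff \<phi>_def by blast
  have E: "\<mu> \<in> sip_eigenvalues c \<beta> 2"
    using sip_eigenvalue_pairI[of c \<phi>, OF sym loop \<phi>(1) ev nz1] by simp
  have "\<mu> \<noteq> 0"
  proof
    assume "\<mu> = 0"
    then have e0: "kernel_energy ?K \<phi> \<phi> = 0" using v(3) by (simp add: \<phi>_def)
    have step: "\<phi> u y = \<phi> x y" if "c x u > 0" for x u y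
    proof (rule kernel_energy_eq_0D[OF K e0])
      show "?K x u y > 0" unfolding pair_conductance_def using that \<beta>
        by (intro mult_pos_pos add_pos_nonneg) auto
    qed
    have "\<phi> u y = \<phi> x y" for x u y
      using conn[of x u] by (induction rule: rtranclp_induct) (simp, metis step)
    then have const: "\<phi> x y = \<phi> x1 y1" for x y by (metis \<phi>(1))
    have "kernel_inner ?w (\<lambda>_ _. 1) \<phi> = \<phi> x1 y1 * Z"
      unfolding kernel_inner_def Z_def sum_distrib_left
      by (intro sum.cong refl) (subst const, simp)
    then show False using \<phi>(2) nz1 Z by simp
  qed
  moreover have "\<mu> \<ge> 0" using sip_eigenvalues_nonneg[OF c less_imp_le[OF \<beta>] E] .
  ultimately have "\<mu> > 0" by simp
  moreover have "\<mu> * (kernel_inner ?w \<psi> \<psi> - (kernel_inner ?w (\<lambda>_ _. 1) \<psi>)\<^sup>2 / Z) \<le> kernel_energy ?K \<psi> \<psi>"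
    if \<psi>: "\<And>x y. \<psi> x y = \<psi> y x" for \<psi>
  proof -
    have "Z \<noteq> 0" using Z by simp
    from min[OF centred[of \<psi>, OF \<psi>]] show ?thesis
      unfolding kernel_of_vec_of kernel_inner_shift(2)[OF Z_def \<open>Z \<noteq> 0\<close> refl] kernel_energy_shift
        kernel_energy_commute[of ?K "\<lambda>x y. \<psi> x y - _"] .
  qed
  ultimately show ?thesis using that E unfolding Z_def by blast
qed

section \<open>Barriers for metastable pairs\<close>

lemma walk_generator_scale: "walk_generator c (\<lambda>x. \<epsilon> * \<alpha> x) a x = \<epsilon> * walk_generator c \<alpha> a x"
  by (simp add: walk_generator_def sum_distrib_left mult_ac)

lemma walk_pair_generator_scale:
  "walk_pair_generator c (\<lambda>x. \<epsilon> * \<alpha> x) \<phi> x y = \<epsilon> * walk_pair_generator c \<alpha> \<phi> x y"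
  by (simp add: walk_pair_generator_def walk_generator_scale distrib_left)

lemma walk_pair_generator_linear:
  "walk_pair_generator c \<alpha> (\<lambda>x y. \<phi> x y + r * \<psi> x y) x y
    = walk_pair_generator c \<alpha> \<phi> x y + r * walk_pair_generator c \<alpha> \<psi> x y"
  by (simp add: walk_pair_generator_def walk_generator_def algebra_simps sum.distrib sum_subtractf sum_distrib_left)

text \<open>Two distinct sites without a common edge form a metastable pair: one particle on each does
  not feel the attraction. A barrier is a strict supersolution at level \<open>\<mu>\<close>, with surplus \<open>\<kappa>\<close>, for
  two independent walks that are killed on leaving the metastable pairs.\<close>

definition pair_barrier ::
  "('v::finite \<Rightarrow> 'v \<Rightarrow> real) \<Rightarrow> ('v \<Rightarrow> real) \<Rightarrow> real \<Rightarrow> real \<Rightarrow> ('v \<Rightarrow> 'v \<Rightarrow> real) \<Rightarrow> bool" where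
  "pair_barrier c \<alpha> \<mu> \<kappa> g \<longleftrightarrow> \<kappa> > 0 \<and> (\<forall>x y. g x y = g y x) \<and>
     (\<forall>x y. x = y \<or> c x y \<noteq> 0 \<longrightarrow> g x y = 0) \<and>
     (\<forall>x y. x \<noteq> y \<longrightarrow> c x y = 0 \<longrightarrow>
        g x y > 0 \<and> walk_pair_generator c \<alpha> g x y \<le> - \<mu> * g x y - \<kappa>)"

text \<open>The lowest Dirichlet eigenvalue \<open>\<mu>\<close> of two independent walks killed on leaving the
  metastable pairs, with a ground state \<open>g0\<close>. The metastable pairs may fall into several components,
  on some of which \<open>g0\<close> vanishes, so it is not yet a barrier. Subtracting a small multiple \<open>\<tau>\<close> of the
  square of the total mass \<open>s\<close> from the energy couples all components: the new ground state \<open>g\<close> can be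
  taken non-negative, it satisfies the eigenvalue equation with the additional constant \<open>\<tau> s g\<close>, and
  this constant forces it to be positive everywhere and serves as the surplus. By the Cauchy-Schwarz
  inequality the eigenvalue drops by at most \<open>\<tau>\<close> times the total weight, which is \<open>\<delta>\<close>.\<close>

lemma metastable_barrier:
  fixes c :: "'v::finite \<Rightarrow> 'v \<Rightarrow> real"
  assumes sym: "\<And>x y. c x y = c y x" and c: "\<And>x y. c x y \<ge> 0" and \<alpha>: "\<And>x. \<alpha> x > 0"
    and pq: "p \<noteq> q" "c p q = 0"
  obtains g0 \<mu> where
    "\<And>x y. g0 x y = g0 y x" "\<And>x y. x = y \<or> c x y \<noteq> 0 \<Longrightarrow> g0 x y = 0"
    "kernel_inner (walk_pair_weight \<alpha>) g0 g0 > 0"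
    "kernel_energy (walk_pair_conductance c \<alpha>) g0 g0 = \<mu> * kernel_inner (walk_pair_weight \<alpha>) g0 g0"
    "\<And>\<delta>. \<delta> > 0 \<Longrightarrow> \<exists>g \<kappa>. pair_barrier c \<alpha> (\<mu> - \<delta>) \<kappa> g"
proof -
  let ?w = "walk_pair_weight \<alpha>" and ?K = "walk_pair_conductance c \<alpha>"
  let ?B = "\<lambda>u v. kernel_inner ?w (kernel_of u) (kernel_of v)"
  let ?E = "\<lambda>u v. kernel_energy ?K (kernel_of u) (kernel_of v)"
  define s where "s \<phi> = kernel_inner ?w (\<lambda>_ _. 1) \<phi>" for \<phi>
  have w: "?w x y > 0" for x y unfolding walk_pair_weight_def using \<alpha> by simp
  have K: "?K x u y \<ge> 0" for x u y
    unfolding walk_pair_conductance_def using \<alpha> c by (intro mult_nonneg_nonneg) (auto intro: less_imp_le)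
  define W where "W = (\<Sum>x\<in>UNIV. \<Sum>y\<in>UNIV. ?w x y)"
  have W: "W > 0" unfolding W_def by (intro sum_pos w) auto
  define U where "U = {v. (\<forall>x y. kernel_of v x y = kernel_of v y x) \<and>
      (\<forall>x y. x = y \<or> c x y \<noteq> 0 \<longrightarrow> kernel_of v x y = 0)}"
  have U: "subspace U" unfolding real_vector.subspace_def U_def by auto
  have pos: "?B v v > 0" if "v \<noteq> 0" for v
  proof -
    have "?B v v \<noteq> 0"
      using that kernel_inner_eq_0D[of ?w, OF w] unfolding kernel_of_eq_0_iff by blast
    moreover have "?B v v \<ge> 0" by (intro kernel_inner_nonneg less_imp_le[OF w])
    ultimately show ?thesis by linarith
  qed
  define v0 where "v0 = vec_of (\<lambda>x y. of_bool (x = p \<and> y = q \<or> x = q \<and> y = p) :: real)"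
  have v0: "v0 \<in> U" using pq sym[of p q] by (auto simp: U_def v0_def)
  have "kernel_of v0 p q \<noteq> 0" by (simp add: v0_def)
  then have v0': "v0 \<noteq> 0" unfolding kernel_of_eq_0_iff by blast
  obtain v \<mu> where v: "v \<in> U" "v \<noteq> 0" "?E v v = \<mu> * ?B v v"
    and min: "\<And>x. x \<in> U \<Longrightarrow> ?E x x \<ge> \<mu> * ?B x x"
    using rayleigh_minimiser[OF bilinear_kernel_energy bilinear_kernel_inner U pos v0 v0', of ?K] by blast
  show thesis
  proof (rule that[of "kernel_of v" \<mu>])
    fix \<delta> :: real assume \<delta>: "\<delta> > 0"
    define \<tau> where "\<tau> = \<delta> / W"
    have \<tau>: "\<tau> > 0" using \<delta> W by (simp add: \<tau>_def)
    define D where "D u v = ?E u v - \<tau> * (s (kernel_of u) * s (kernel_of v))" for u v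
    have D: "bilinear D"
    proof -
      have E: "bilinear ?E" by (rule bilinear_kernel_energy)
      have "s (kernel_of (u + v)) = s (kernel_of u) + s (kernel_of v)"
        "s (kernel_of (r *\<^sub>R u)) = r * s (kernel_of u)" for u v r
        by (simp_all add: s_def kernel_inner_def algebra_simps sum.distrib sum_distrib_left)
      then show ?thesis
        unfolding bilinear_def D_def
        by (auto intro!: linearI simp: bilinear_ladd[OF E] bilinear_radd[OF E] bilinear_lmul[OF E]
            bilinear_rmul[OF E] algebra_simps)
    qed
    have Dsym: "D u v = D v u" for u v
      unfolding D_def by (subst kernel_energy_commute) (simp add: mult.commute)
    obtain v1 \<nu> where v1: "v1 \<in> U" "v1 \<noteq> 0" "D v1 v1 = \<nu> * ?B v1 v1"
      and min1: "\<And>x. x \<in> U \<Longrightarrow> D x x \<ge> \<nu> * ?B x x"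
      using rayleigh_minimiser[OF D bilinear_kernel_inner U pos v0 v0'] by blast
    define g where "g x y = \<bar>kernel_of v1 x y\<bar>" for x y
    have g0: "g x y \<ge> 0" for x y by (simp add: g_def)
    have gU: "vec_of g \<in> U" using v1(1) by (auto simp: U_def g_def)
    have gsym: "g x y = g y x" for x y using v1(1) by (simp add: U_def g_def)
    have Bg: "kernel_inner ?w g g = ?B v1 v1" by (simp add: kernel_inner_def g_def mult.assoc)
    have gnz: "\<exists>x y. g x y > 0" using v1(2) unfolding kernel_of_eq_0_iff by (auto simp: g_def)
    have spos: "s g > 0"
    proof -
      obtain x y where xy: "g x y > 0" using gnz by blast
      have "s g \<noteq> 0"
      proof
        assume "s g = 0"
        then have "(\<Sum>x\<in>UNIV. \<Sum>y\<in>UNIV. ?w x y * g x y) = 0"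
          by (simp add: s_def kernel_inner_def)
        then have "?w x y * g x y = 0"
          by (rule sum2_eq_0D[rotated]) (intro mult_nonneg_nonneg less_imp_le[OF w] g0)
        then show False using xy w[of x y] by simp
      qed
      moreover have "s g \<ge> 0" unfolding s_def kernel_inner_def
        by (intro sum_nonneg mult_nonneg_nonneg less_imp_le[OF w] g0) simp
      ultimately show ?thesis by linarith
    qed
    \<comment> \<open>Passing to absolute values lowers the energy and raises the total mass.\<close>
    have abs_s: "(s (kernel_of v1))\<^sup>2 \<le> (s g)\<^sup>2"
    proof -
      have "\<bar>s (kernel_of v1)\<bar> \<le> (\<Sum>x\<in>UNIV. \<bar>\<Sum>y\<in>UNIV. ?w x y * 1 * kernel_of v1 x y\<bar>)"
        unfolding s_def kernel_inner_def by (rule sum_abs)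
      also have "\<dots> \<le> (\<Sum>x\<in>UNIV. \<Sum>y\<in>UNIV. \<bar>?w x y * 1 * kernel_of v1 x y\<bar>)"
        by (intro sum_mono sum_abs)
      also have "\<dots> = s g"
        unfolding s_def kernel_inner_def g_def using w by (intro sum.cong refl) (simp add: abs_mult less_imp_le)
      finally show ?thesis using spos by (metis abs_le_square_iff abs_of_pos)
    qed
    have "kernel_energy ?K g g \<le> ?E v1 v1"
      unfolding g_def by (rule kernel_energy_abs[OF K])
    moreover have "\<tau> * (s (kernel_of v1))\<^sup>2 \<le> \<tau> * (s g)\<^sup>2"
      using abs_s \<tau> by simp
    ultimately have "D (vec_of g) (vec_of g) \<le> D v1 v1"
      by (simp add: D_def power2_eq_square)
    then have gmin: "D (vec_of g) (vec_of g) = \<nu> * ?B (vec_of g) (vec_of g)"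
      using v1(3) min1[OF gU] Bg by simp
    have \<nu>: "\<nu> \<ge> \<mu> - \<delta>"
    proof -
      have "0 \<le> kernel_inner ?w g g - (s g)\<^sup>2 / W"
      proof -
        have "W \<noteq> 0" using W by simp
        have "0 \<le> kernel_inner ?w (\<lambda>x y. g x y - s g / W) (\<lambda>x y. g x y - s g / W)"
          by (intro kernel_inner_nonneg less_imp_le[OF w])
        also have "\<dots> = kernel_inner ?w g g - (s g)\<^sup>2 / W"
          unfolding s_def by (rule kernel_inner_shift(2)[OF W_def \<open>W \<noteq> 0\<close> refl])
        finally show ?thesis .
      qed
      then have "\<delta> * ((s g)\<^sup>2 / W) \<le> \<delta> * kernel_inner ?w g g"
        using \<delta> by (intro mult_left_mono) auto
      moreover have "\<mu> * kernel_inner ?w g g \<le> kernel_energy ?K g g" using min[OF gU] by simp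
      moreover have "kernel_energy ?K g g - \<tau> * (s g)\<^sup>2 = \<nu> * kernel_inner ?w g g"
        using gmin by (simp add: D_def power2_eq_square)
      ultimately have "(\<mu> - \<delta>) * kernel_inner ?w g g \<le> \<nu> * kernel_inner ?w g g"
        by (simp add: \<tau>_def algebra_simps)
      moreover have "kernel_inner ?w g g > 0" unfolding Bg by (rule pos[OF v1(2)])
      ultimately show ?thesis by (simp add: mult_le_cancel_right_pos)
    qed
    have eq: "walk_pair_generator c \<alpha> g x y = - \<nu> * g x y - \<tau> * s g" if xy: "x \<noteq> y" "c x y = 0" for x y
    proof -
      define r where "r x y = walk_pair_generator c \<alpha> g x y + \<nu> * g x y + \<tau> * s g" for x y
      define \<rho> where "\<rho> x y = (if x \<noteq> y \<and> c x y = 0 then r x y else 0)" for x y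
      have \<rho>sym: "\<rho> x y = \<rho> y x" for x y
        using gsym[of x y] symmetric_walk_pair_generator[of c \<alpha> g x y] sym[of x y]
        by (auto simp: \<rho>_def r_def)
      have \<rho>U: "vec_of \<rho> \<in> U" using \<rho>sym by (auto simp: U_def) (auto simp: \<rho>_def)
      have "D (vec_of g) (vec_of \<rho>) = \<nu> * ?B (vec_of g) (vec_of \<rho>)"
        by (rule rayleigh_stationary[OF D Dsym bilinear_kernel_inner kernel_inner_commute U gU gmin min1 \<rho>U])
      then have stat: "kernel_energy ?K g \<rho> = \<nu> * kernel_inner ?w g \<rho> + \<tau> * (s g * s \<rho>)"
        by (simp add: D_def)
      have "kernel_inner ?w \<rho> \<rho> = kernel_inner ?w \<rho> r"
        unfolding kernel_inner_def by (intro sum.cong refl) (simp add: \<rho>_def)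
      also have "\<dots> = kernel_inner ?w \<rho> (walk_pair_generator c \<alpha> g) + \<nu> * kernel_inner ?w g \<rho> + \<tau> * (s g * s \<rho>)"
        unfolding kernel_inner_def[of ?w \<rho>] kernel_inner_def[of ?w g \<rho>] s_def[of \<rho>] kernel_inner_def[of ?w "\<lambda>_ _. 1"]
          sum_distrib_left sum.distrib[symmetric]
        by (intro sum.cong refl) (simp add: r_def algebra_simps)
      also have "\<dots> = 0"
        unfolding walk_pair_generator_energy[of c \<rho>, OF sym \<rho>sym] stat by simp
      finally have "\<rho> x y = 0" using kernel_inner_eq_0D[of ?w, OF w] by blast
      then show ?thesis using xy by (simp add: \<rho>_def r_def)
    qed
    have gpos: "g x y > 0" if "x \<noteq> y" "c x y = 0" for x y
    proof (rule ccontr)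
      assume "\<not> g x y > 0"
      then have z: "g x y = 0" "g y x = 0" using g0[of x y] gsym[of x y] by auto
      have "walk_pair_generator c \<alpha> g x y \<ge> 0"
        unfolding walk_pair_generator_def walk_generator_def z using c \<alpha> g0
        by (intro add_nonneg_nonneg sum_nonneg mult_nonneg_nonneg) (auto intro: less_imp_le)
      then show False using eq[OF that] z(1) mult_pos_pos[OF \<tau> spos] by simp
    qed
    have "walk_pair_generator c \<alpha> g x y \<le> - (\<mu> - \<delta>) * g x y - \<tau> * s g" if "x \<noteq> y" "c x y = 0" for x y
      using eq[OF that] mult_right_mono[OF \<nu> g0[of x y]] by (simp add: algebra_simps)
    then show "\<exists>g \<kappa>. pair_barrier c \<alpha> (\<mu> - \<delta>) \<kappa> g"
      using mult_pos_pos[OF \<tau> spos] gsym gpos gU unfolding pair_barrier_def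
      by (intro exI[of _ g] exI[of _ "\<tau> * s g"]) (auto simp: U_def)
  qed (use v pos in \<open>auto simp: U_def\<close>)
qed

section \<open>Low eigenvalues at small weights\<close>

lemma tendsto_affine_at_right_0: "((\<lambda>\<epsilon>::real. a + \<epsilon> * b) \<longlongrightarrow> a) (at_right 0)"
proof -
  have "((\<lambda>\<epsilon>::real. a + \<epsilon> * b) \<longlongrightarrow> a + 0 * b) (at_right 0)"
    by (intro tendsto_intros)
  then show ?thesis by simp
qed

text \<open>The barrier \<open>g\<close> is extended by the value \<open>\<epsilon> B\<close> to adjacent pairs. An adjacent pair coalesces
  at a rate of order one, which yields a decay of \<open>2 \<epsilon> B c x y\<close> and, for large \<open>B\<close>, outweighs the
  inflow of order \<open>\<epsilon>\<close> from the metastable pairs. The error made on metastable pairs and the leak onto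
  the diagonal are both of order \<open>\<epsilon>\<^sup>2\<close>, while the surplus is of order \<open>\<epsilon>\<close>. Below the level of the barrier
  there are then only eigenvalues of the single walk, and these occur for two particles too.\<close>

lemma low_eigenvalues_are_two_particle_eigenvalues:
  fixes c :: "'v::finite \<Rightarrow> 'v \<Rightarrow> real"
  assumes sym: "\<And>x y. c x y = c y x" and c: "\<And>x y. c x y \<ge> 0" and loop: "\<And>x. c x x = 0"
    and \<alpha>: "\<And>x. \<alpha> x > 0" and k: "k \<ge> 1"
    and barrier: "pair_barrier c \<alpha> \<mu> \<kappa> g"
  shows "\<forall>\<^sub>F \<epsilon> in at_right 0. \<forall>\<mu>' \<in> sip_eigenvalues c (\<lambda>x. \<epsilon> * \<alpha> x) k. \<mu>' \<le> \<epsilon> * \<mu> \<longrightarrow>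
           \<mu>' \<in> sip_eigenvalues c (\<lambda>x. \<epsilon> * \<alpha> x) 2"
proof -
  have \<kappa>: "\<kappa> > 0"
    and g: "\<And>x y. g x y = g y x" "\<And>x y. x = y \<or> c x y \<noteq> 0 \<Longrightarrow> g x y = 0"
      "\<And>x y. x \<noteq> y \<Longrightarrow> c x y = 0 \<Longrightarrow> g x y > 0"
    and super: "\<And>x y. x \<noteq> y \<Longrightarrow> c x y = 0 \<Longrightarrow> walk_pair_generator c \<alpha> g x y \<le> - \<mu> * g x y - \<kappa>"
    using barrier unfolding pair_barrier_def by blast+
  define adj where "adj x y = (of_bool (c x y > 0) :: real)" for x y
  have adjsym: "adj x y = adj y x" for x y by (simp add: adj_def sym[of x y])
  define A where "A x y = walk_pair_generator c \<alpha> g x y" for x y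
  define A' where "A' x y = walk_pair_generator c \<alpha> adj x y" for x y
  define h where "h x y = (\<bar>A x y\<bar> + \<kappa>) / c x y" for x y
  have h0: "h x y \<ge> 0" for x y unfolding h_def using c \<kappa> by (intro divide_nonneg_nonneg) auto
  \<comment> \<open>Large enough for the decay of adjacent pairs at rate of order one to beat their coupling to \<open>g\<close>.\<close>
  define B where "B = 1 + (\<Sum>x\<in>UNIV. \<Sum>y\<in>UNIV. h x y)"
  have B: "B > 0" unfolding B_def using h0 by (intro add_pos_nonneg sum_nonneg) auto
  have hB: "h x y \<le> B" for x y
  proof -
    have "h x y \<le> sum (h x) UNIV" by (rule member_le_sum) (simp_all add: h0)
    also have "\<dots> \<le> (\<Sum>x\<in>UNIV. sum (h x) UNIV)"
      by (rule member_le_sum[where f = "\<lambda>x. sum (h x) UNIV"]) (simp_all add: h0 sum_nonneg)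
    finally show ?thesis by (simp add: B_def)
  qed
  define a where "a x y = A x y - 2 * B * c x y + \<mu> * g x y + \<kappa> / 2" for x y
  define b where "b x y = B * A' x y + \<mu> * B * adj x y" for x y
  have a: "a x y < 0" if "x \<noteq> y" for x y
  proof (cases "c x y = 0")
    case True
    then show ?thesis using super[OF that True] \<kappa> by (simp add: a_def A_def)
  next
    case False
    then have cp: "c x y > 0" using c[of x y] by simp
    have "\<bar>A x y\<bar> + \<kappa> \<le> B * c x y" using hB[of x y] cp by (simp add: h_def pos_divide_le_eq)
    moreover have "B * c x y > 0" using B cp by simp
    ultimately have "A x y - 2 * (B * c x y) + \<kappa> / 2 < 0" using \<kappa> by linarith
    then show ?thesis using g(2)[of x y] False by (simp add: a_def)
  qed
  define d where "d = (\<Sum>x\<in>UNIV. \<bar>B * A' x x\<bar>)"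
  have d0: "d \<ge> 0" unfolding d_def by (intro sum_nonneg) auto
  have ev1: "\<forall>\<^sub>F \<epsilon> in at_right 0. \<forall>x y. x \<noteq> y \<longrightarrow> a x y + \<epsilon> * b x y < 0"
  proof (intro eventually_all_finite)
    fix x y
    show "\<forall>\<^sub>F \<epsilon> in at_right 0. x \<noteq> y \<longrightarrow> a x y + \<epsilon> * b x y < 0"
      using order_tendstoD(2)[OF tendsto_affine_at_right_0, of "a x y" 0 "b x y"] a[of x y]
      by (cases "x = y") auto
  qed
  have ev2: "\<forall>\<^sub>F \<epsilon> in at_right 0. 0 + \<epsilon> * (2 * (real k * (real k - 1)) * d) < \<kappa> / 2"
    using \<kappa> by (intro order_tendstoD(2)[OF tendsto_affine_at_right_0]) simp
  have ev3: "\<forall>\<^sub>F \<epsilon> in at_right 0. \<epsilon> > (0::real)" by (simp add: eventually_at_right_less)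
  show ?thesis
    using ev1 ev2 ev3
  proof eventually_elim
    case (elim \<epsilon>)
    then have \<epsilon>: "\<epsilon> > 0" by simp
    define \<phi> where "\<phi> x y = g x y + (\<epsilon> * B) * adj x y" for x y
    have \<phi>sym: "\<phi> x y = \<phi> y x" for x y by (simp add: \<phi>_def g(1)[of x y] adjsym[of x y])
    have \<phi>diag: "\<phi> x x = 0" for x using g(2)[of x x] loop[of x] by (simp add: \<phi>_def adj_def)
    have \<phi>pos: "\<phi> x y > 0" if "x \<noteq> y" for x y
      using g(2,3)[of x y] that \<epsilon> B c[of x y] by (cases "c x y = 0") (auto simp: \<phi>_def adj_def)
    have gen: "pair_generator c (\<lambda>x. \<epsilon> * \<alpha> x) \<phi> x y
        = \<epsilon> * (A x y + \<epsilon> * (B * A' x y)) + c x y * (\<phi> y y - \<phi> x y) + c y x * (\<phi> x x - \<phi> y x)" for x y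
      unfolding pair_generator_split walk_pair_generator_scale \<phi>_def walk_pair_generator_linear A_def A'_def
      by (simp add: mult.assoc)
    have gen_off: "pair_generator c (\<lambda>x. \<epsilon> * \<alpha> x) \<phi> x y \<le> - (\<epsilon> * \<mu>) * \<phi> x y - \<epsilon> * \<kappa> / 2" if "x \<noteq> y" for x y
    proof -
      have c\<phi>: "c x y * \<phi> x y = \<epsilon> * B * c x y"
        using g(2)[of x y] c[of x y] by (cases "c x y = 0") (auto simp: \<phi>_def adj_def)
      have "pair_generator c (\<lambda>x. \<epsilon> * \<alpha> x) \<phi> x y + (\<epsilon> * \<mu>) * \<phi> x y + \<epsilon> * \<kappa> / 2
          = \<epsilon> * (A x y + \<epsilon> * (B * A' x y)) - 2 * (c x y * \<phi> x y) + (\<epsilon> * \<mu>) * \<phi> x y + \<epsilon> * \<kappa> / 2"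
        unfolding gen \<phi>diag sym[of y x] \<phi>sym[of y x] by simp
      also have "\<dots> = \<epsilon> * (a x y + \<epsilon> * b x y)"
        unfolding c\<phi> by (simp add: a_def b_def \<phi>_def algebra_simps)
      also have "\<dots> \<le> 0"
        using elim(1) that \<epsilon> by (intro mult_nonneg_nonpos) (auto intro: less_imp_le)
      finally show ?thesis by simp
    qed
    have gen_diag: "pair_generator c (\<lambda>x. \<epsilon> * \<alpha> x) \<phi> x x \<le> \<epsilon>\<^sup>2 * d" for x
    proof -
      have "A x x = 0"
        unfolding A_def walk_pair_generator_def walk_generator_def
        using g(2) sym by (auto intro!: sum.neutral)
      then have "pair_generator c (\<lambda>x. \<epsilon> * \<alpha> x) \<phi> x x = \<epsilon>\<^sup>2 * (B * A' x x)"
        unfolding gen by (simp add: loop power2_eq_square)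
      also have "B * A' x x \<le> \<bar>B * A' x x\<bar>" by simp
      also have "\<dots> \<le> d" unfolding d_def by (rule member_le_sum[where f = "\<lambda>x. \<bar>B * A' x x\<bar>"]) auto
      finally show ?thesis by (simp add: mult_left_mono)
    qed
    have leak: "2 * (real k * (real k - 1)) * (\<epsilon>\<^sup>2 * d) < \<epsilon> * \<kappa> / 2"
      using mult_strict_left_mono[OF elim(2) \<epsilon>] by (simp add: power2_eq_square mult_ac)
    show ?case
    proof (intro ballI impI)
      fix \<mu>' assume \<mu>': "\<mu>' \<in> sip_eigenvalues c (\<lambda>x. \<epsilon> * \<alpha> x) k" "\<mu>' \<le> \<epsilon> * \<mu>"
      have \<beta>: "\<epsilon> * \<alpha> x \<ge> 0" for x using \<epsilon> \<alpha> by (simp add: less_imp_le)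
      have "\<epsilon>\<^sup>2 * d \<ge> 0" using d0 by simp
      obtain a x0 where a: "a x0 \<noteq> 0" "\<And>x. walk_generator c (\<lambda>x. \<epsilon> * \<alpha> x) a x = - \<mu>' * a x"
        using eigenvalue_below_pair_barrier_is_walk_eigenvalue[of c "\<lambda>x. \<epsilon> * \<alpha> x" k \<phi>, OF sym loop c \<beta> k
            \<phi>sym \<phi>diag \<phi>pos gen_off gen_diag \<open>\<epsilon>\<^sup>2 * d \<ge> 0\<close> leak \<mu>'] by blast
      then show "\<mu>' \<in> sip_eigenvalues c (\<lambda>x. \<epsilon> * \<alpha> x) 2"
        by (intro sip_eigenvalue_walkI[of c "\<lambda>x. \<epsilon> * \<alpha> x" a \<mu>' x0 2, OF sym]) simp_all
    qed
  qed
qed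

section \<open>Upper bounds for the two-particle gap\<close>

lemma pair_weight_sum_ge:
  fixes \<beta> :: "'v::finite \<Rightarrow> real"
  assumes "\<And>x. \<beta> x > 0" "p \<noteq> q"
  shows "(\<Sum>x\<in>UNIV. \<Sum>y\<in>UNIV. pair_weight \<beta> x y) \<ge> pair_weight \<beta> p p + pair_weight \<beta> q q"
proof -
  have w: "pair_weight \<beta> x y \<ge> 0" for x y
    unfolding pair_weight_def using assms(1) by (intro mult_nonneg_nonneg add_nonneg_nonneg) (auto intro: less_imp_le)
  have "pair_weight \<beta> p p + pair_weight \<beta> q q = (\<Sum>x\<in>{p, q}. pair_weight \<beta> x x)" using assms(2) by simp
  also have "\<dots> \<le> (\<Sum>x\<in>UNIV. pair_weight \<beta> x x)" using w by (intro sum_mono2) auto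
  also have "\<dots> \<le> (\<Sum>x\<in>UNIV. \<Sum>y\<in>UNIV. pair_weight \<beta> x y)"
    by (intro sum_mono member_le_sum) (auto simp: w)
  finally show ?thesis .
qed

text \<open>The test kernel is the indicator of both particles sitting at \<open>p\<close>. Its mass and the total
  mass are of order \<open>\<epsilon>\<close>, and so is the mass it misses, since a condensate at another site \<open>q\<close> has
  weight of order \<open>\<epsilon>\<close>. An edge of positive conductance carries at most one of the two attraction terms,
  so the energy is of order \<open>\<epsilon>\<^sup>2\<close>.\<close>

lemma two_particle_gap_linear_bound:
  fixes c :: "'v::finite \<Rightarrow> 'v \<Rightarrow> real"
  assumes graph: "connected_weighted_graph c" and \<alpha>: "\<And>x. \<alpha> x > 0"
  obtains b where "\<And>\<epsilon>. 0 < \<epsilon> \<Longrightarrow> \<epsilon> \<le> 1 \<Longrightarrow> sip_gap c (\<lambda>x. \<epsilon> * \<alpha> x) 2 \<le> \<epsilon> * b"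
proof -
  have c: "\<And>x y. c x y \<ge> 0" and loop: "\<And>x. c x x = 0" and two: "CARD('v) \<ge> 2"
    using graph unfolding connected_weighted_graph_def by blast+
  obtain p q :: 'v where pq: "p \<noteq> q" using two_vertices[OF two] by blast
  define \<phi> :: "'v \<Rightarrow> 'v \<Rightarrow> real" where "\<phi> x y = of_bool (x = p \<and> y = p)" for x y
  define C1 where "C1 = (\<Sum>x\<in>UNIV. \<Sum>u\<in>UNIV. \<Sum>y\<in>UNIV. c x u * \<alpha> y * (\<alpha> x + 1) * (\<alpha> u + 1))"
  define C2 where "C2 = (\<Sum>x\<in>UNIV. \<Sum>y\<in>UNIV. \<alpha> y * (\<alpha> x + 1))"
  have C2: "C2 > 0" unfolding C2_def using \<alpha> by (intro sum_pos mult_pos_pos add_pos_pos) auto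
  show thesis
  proof (rule that[of "C1 * C2 / (\<alpha> p * \<alpha> q)"])
    fix \<epsilon> :: real assume \<epsilon>: "0 < \<epsilon>" "\<epsilon> \<le> 1"
    let ?\<beta> = "\<lambda>x. \<epsilon> * \<alpha> x"
    let ?w = "pair_weight ?\<beta>" and ?K = "pair_conductance c ?\<beta>"
    have \<beta>: "?\<beta> x > 0" for x using \<epsilon> \<alpha> by simp
    define Z where "Z = (\<Sum>x\<in>UNIV. \<Sum>y\<in>UNIV. ?w x y)"
    obtain \<mu> where \<mu>: "\<mu> \<in> sip_eigenvalues c ?\<beta> 2" "\<mu> > 0"
      and bound: "\<And>\<phi>. (\<And>x y. \<phi> x y = \<phi> y x) \<Longrightarrow>
       \<mu> * (kernel_inner ?w \<phi> \<phi> - (kernel_inner ?w (\<lambda>_ _. 1) \<phi>)\<^sup>2 / Z) \<le> kernel_energy ?K \<phi> \<phi>"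
      using two_particle_spectral_bound[of c ?\<beta>, OF graph \<beta>] unfolding Z_def by blast
    have \<alpha>0: "\<alpha> x \<ge> 0" "\<alpha> x + 1 \<ge> 0" for x using \<alpha>[of x] by simp_all
    have small: "\<epsilon> * \<alpha> x \<le> \<alpha> x" for x using \<epsilon> \<alpha>[of x] by (simp add: mult_le_cancel_right2)
    have energy: "kernel_energy ?K \<phi> \<phi> \<le> \<epsilon>\<^sup>2 * C1"
      unfolding kernel_energy_def C1_def sum_distrib_left
    proof (intro sum_mono)
      fix x u y
      have sq: "(\<phi> u y - \<phi> x y) * (\<phi> u y - \<phi> x y) \<le> 1" by (simp add: \<phi>_def)
      have K0: "?K x u y \<ge> 0" unfolding pair_conductance_def using c \<alpha> \<epsilon>
        by (intro mult_nonneg_nonneg add_nonneg_nonneg) (auto intro: less_imp_le)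
      have "?K x u y * (\<phi> u y - \<phi> x y) * (\<phi> u y - \<phi> x y) \<le> ?K x u y * 1"
        unfolding mult.assoc by (intro mult_left_mono sq K0)
      also have "\<dots> \<le> \<epsilon>\<^sup>2 * (c x u * \<alpha> y * (\<alpha> x + 1) * (\<alpha> u + 1))"
      proof (cases "x = u")
        case True
        then show ?thesis by (simp add: pair_conductance_def loop)
      next
        case False
        have "(?\<beta> x + of_bool (x = y)) * (?\<beta> u + of_bool (u = y)) \<le> \<epsilon> * ((\<alpha> x + 1) * (\<alpha> u + 1))"
        proof (cases "x = y")
          case True
          then have "(?\<beta> x + of_bool (x = y)) * (?\<beta> u + of_bool (u = y)) = (?\<beta> x + 1) * ?\<beta> u"
            using False by simp
          also have "\<dots> \<le> (\<alpha> x + 1) * (\<epsilon> * (\<alpha> u + 1))"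
            using small[of x] \<epsilon> \<alpha>0 by (intro mult_mono) auto
          finally show ?thesis by (simp add: mult_ac)
        next
          case False
          then have "(?\<beta> x + of_bool (x = y)) * (?\<beta> u + of_bool (u = y)) \<le> (\<epsilon> * (\<alpha> x + 1)) * (\<alpha> u + 1)"
            using small[of u] \<epsilon> \<alpha>0 by (intro mult_mono) (auto simp: distrib_left intro: add_mono)
          then show ?thesis by (simp add: mult_ac)
        qed
        then have "c x u * ?\<beta> y * ((?\<beta> x + of_bool (x = y)) * (?\<beta> u + of_bool (u = y)))
            \<le> c x u * ?\<beta> y * (\<epsilon> * ((\<alpha> x + 1) * (\<alpha> u + 1)))"
          using c \<epsilon> \<alpha>0 by (intro mult_left_mono) (auto intro!: mult_nonneg_nonneg)
        then show ?thesis by (simp add: pair_conductance_def power2_eq_square mult_ac)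
      qed
      finally show "?K x u y * (\<phi> u y - \<phi> x y) * (\<phi> u y - \<phi> x y) \<le> \<epsilon>\<^sup>2 * (c x u * \<alpha> y * (\<alpha> x + 1) * (\<alpha> u + 1))" .
    qed
    define w where "w = ?w p p"
    have w: "w \<ge> \<epsilon> * \<alpha> p" "?w q q \<ge> \<epsilon> * \<alpha> q"
      using \<beta>[of p] \<beta>[of q] by (simp_all add: w_def pair_weight_def distrib_left)
    have mass: "kernel_inner ?w \<phi> \<phi> = w" "kernel_inner ?w (\<lambda>_ _. 1) \<phi> = w"
    proof -
      have "kernel_inner ?w \<psi> \<phi> = w" if "\<psi> p p = 1" for \<psi>
      proof -
        have "kernel_inner ?w \<psi> \<phi> = (\<Sum>x\<in>UNIV. \<Sum>y\<in>UNIV. if y = p then (if x = p then w else 0) else 0)"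
          unfolding kernel_inner_def by (intro sum.cong refl) (auto simp: \<phi>_def w_def that)
        then show ?thesis by simp
      qed
      then show "kernel_inner ?w \<phi> \<phi> = w" "kernel_inner ?w (\<lambda>_ _. 1) \<phi> = w" by (simp_all add: \<phi>_def)
    qed
    have Zge: "Z \<ge> w + \<epsilon> * \<alpha> q"
      using pair_weight_sum_ge[of ?\<beta> p q, OF \<beta> pq] w(2) by (simp add: Z_def w_def)
    have wpos: "w > 0" using w(1) \<beta>[of p] by linarith
    have Zpos: "Z > 0" using Zge wpos \<beta>[of q] by linarith
    have Zle: "Z \<le> \<epsilon> * C2"
      unfolding Z_def C2_def sum_distrib_left pair_weight_def
    proof (intro sum_mono)
      fix x y
      have "?\<beta> y * (?\<beta> x + of_bool (x = y)) \<le> ?\<beta> y * (\<alpha> x + 1)"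
        using small[of x] \<beta>[of y] by (intro mult_left_mono add_mono) auto
      then show "?\<beta> y * (?\<beta> x + of_bool (x = y)) \<le> \<epsilon> * (\<alpha> y * (\<alpha> x + 1))" by (simp add: mult_ac)
    qed
    have "\<mu> * (w - w\<^sup>2 / Z) \<le> \<epsilon>\<^sup>2 * C1"
      using bound[of \<phi>] energy unfolding mass by (simp add: \<phi>_def conj_commute)
    also have "w - w\<^sup>2 / Z = w * (Z - w) / Z" using Zpos by (simp add: field_simps power2_eq_square)
    finally have m1: "\<mu> * (w * (Z - w)) \<le> \<epsilon>\<^sup>2 * C1 * Z" using Zpos by (simp add: pos_divide_le_eq)
    have "\<mu> * (\<epsilon> * \<alpha> p * (\<epsilon> * \<alpha> q)) \<le> \<mu> * (w * (Z - w))"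
      using w(1) Zge \<mu>(2) \<beta>[of p] \<beta>[of q] wpos by (intro mult_left_mono mult_mono) auto
    also note m1
    also have "\<epsilon>\<^sup>2 * C1 * Z \<le> \<epsilon>\<^sup>2 * C1 * (\<epsilon> * C2)"
    proof (rule mult_left_mono[OF Zle])
      have "C1 \<ge> 0" unfolding C1_def using c \<alpha>
        by (intro sum_nonneg mult_nonneg_nonneg add_nonneg_nonneg) (auto intro: less_imp_le)
      then show "0 \<le> \<epsilon>\<^sup>2 * C1" by simp
    qed
    finally have "\<epsilon>\<^sup>2 * (\<mu> * (\<alpha> p * \<alpha> q)) \<le> \<epsilon>\<^sup>2 * (\<epsilon> * (C1 * C2))"
      by (simp add: power2_eq_square mult_ac)
    then have "\<mu> * (\<alpha> p * \<alpha> q) \<le> \<epsilon> * (C1 * C2)" using \<epsilon> by simp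
    then have "\<mu> \<le> \<epsilon> * (C1 * C2 / (\<alpha> p * \<alpha> q))"
      using \<alpha>[of p] \<alpha>[of q] by (simp add: pos_le_divide_eq)
    moreover have "sip_gap c ?\<beta> 2 \<le> \<mu>"
      using sip_gap_le[OF c less_imp_le[OF \<beta>] \<mu>(1)] \<mu>(2) by simp
    ultimately show "sip_gap c ?\<beta> 2 \<le> \<epsilon> * (C1 * C2 / (\<alpha> p * \<alpha> q))" by linarith
  qed
qed

text \<open>The ground state of the metastable pairs as a test kernel. It vanishes wherever attraction
  is felt, so its energy and mass are those for two independent walks, of orders \<open>\<epsilon>\<^sup>3\<close> and \<open>\<epsilon>\<^sup>2\<close>. Centring
  costs only the order \<open>\<epsilon>\<^sup>3\<close>, because nearly all of the mass sits on the condensates.\<close>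

lemma two_particle_gap_metastable_bound:
  fixes c :: "'v::finite \<Rightarrow> 'v \<Rightarrow> real"
  assumes graph: "connected_weighted_graph c" and \<alpha>: "\<And>x. \<alpha> x > 0"
    and g: "\<And>x y. g x y = g y x" "\<And>x y. x = y \<or> c x y \<noteq> 0 \<Longrightarrow> g x y = 0"
    and mass: "kernel_inner (walk_pair_weight \<alpha>) g g > 0"
    and energy: "kernel_energy (walk_pair_conductance c \<alpha>) g g = \<mu> * kernel_inner (walk_pair_weight \<alpha>) g g"
  obtains C where "\<And>\<epsilon>. 0 < \<epsilon> \<Longrightarrow> \<epsilon> * C < 1 \<Longrightarrow> sip_gap c (\<lambda>x. \<epsilon> * \<alpha> x) 2 * (1 - \<epsilon> * C) \<le> \<epsilon> * \<mu>"
proof -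
  have c: "\<And>x y. c x y \<ge> 0" and loop: "\<And>x. c x x = 0" and sym: "\<And>x y. c x y = c y x" and two: "CARD('v) \<ge> 2"
    using graph unfolding connected_weighted_graph_def by blast+
  obtain p q :: 'v where pq: "p \<noteq> q" using two_vertices[OF two] by blast
  define M where "M = kernel_inner (walk_pair_weight \<alpha>) g g"
  define s where "s = kernel_inner (walk_pair_weight \<alpha>) (\<lambda>_ _. 1) g"
  have M: "M > 0" using mass by (simp add: M_def)
  show thesis
  proof (rule that[of "s\<^sup>2 / (\<alpha> q * M)"])
    fix \<epsilon> :: real assume \<epsilon>: "0 < \<epsilon>" "\<epsilon> * (s\<^sup>2 / (\<alpha> q * M)) < 1"
    let ?\<beta> = "\<lambda>x. \<epsilon> * \<alpha> x"
    let ?w = "pair_weight ?\<beta>" and ?K = "pair_conductance c ?\<beta>"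
    have \<beta>: "?\<beta> x > 0" for x using \<epsilon> \<alpha> by simp
    define Z where "Z = (\<Sum>x\<in>UNIV. \<Sum>y\<in>UNIV. ?w x y)"
    obtain \<mu>' where \<mu>': "\<mu>' \<in> sip_eigenvalues c ?\<beta> 2" "\<mu>' > 0"
      and bound: "\<And>\<phi>. (\<And>x y. \<phi> x y = \<phi> y x) \<Longrightarrow>
       \<mu>' * (kernel_inner ?w \<phi> \<phi> - (kernel_inner ?w (\<lambda>_ _. 1) \<phi>)\<^sup>2 / Z) \<le> kernel_energy ?K \<phi> \<phi>"
      using two_particle_spectral_bound[of c ?\<beta>, OF graph \<beta>] unfolding Z_def by blast
    have inner: "kernel_inner ?w \<psi> g = \<epsilon>\<^sup>2 * kernel_inner (walk_pair_weight \<alpha>) \<psi> g" for \<psi>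
      unfolding kernel_inner_def sum_distrib_left
    proof (intro sum.cong refl)
      fix x y
      show "?w x y * \<psi> x y * g x y = \<epsilon>\<^sup>2 * (walk_pair_weight \<alpha> x y * \<psi> x y * g x y)"
        using g(2)[of x y] by (cases "x = y") (simp_all add: pair_weight_def walk_pair_weight_def power2_eq_square)
    qed
    \<comment> \<open>An edge of pair space touching the diagonal joins two points at which \<open>g\<close> vanishes.\<close>
    have en: "kernel_energy ?K g g = \<epsilon> ^ 3 * kernel_energy (walk_pair_conductance c \<alpha>) g g"
      unfolding kernel_energy_def sum_distrib_left
    proof (intro sum.cong refl)
      fix x u y
      show "?K x u y * (g u y - g x y) * (g u y - g x y)
          = \<epsilon> ^ 3 * (walk_pair_conductance c \<alpha> x u y * (g u y - g x y) * (g u y - g x y))"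
      proof (cases "c x u = 0 \<or> x \<noteq> y \<and> u \<noteq> y")
        case True
        then show ?thesis by (auto simp: pair_conductance_def walk_pair_conductance_def power3_eq_cube)
      next
        case False
        then have "g u y = 0" "g x y = 0" using g(2)[of u y] g(2)[of x y] sym[of u x] by auto
        then show ?thesis by simp
      qed
    qed
    have Zge: "Z \<ge> \<epsilon> * \<alpha> q"
      using pair_weight_sum_ge[of ?\<beta> p q, OF \<beta> pq] \<beta>[of q] \<beta>[of p]
      by (simp add: Z_def pair_weight_def distrib_left) (smt (verit) zero_le_square)
    have "\<mu>' * (\<epsilon>\<^sup>2 * M - (\<epsilon>\<^sup>2 * s)\<^sup>2 / Z) \<le> \<epsilon> ^ 3 * (\<mu> * M)"
      using bound[of g] g(1) unfolding inner en energy M_def s_def by blast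
    moreover have "(\<epsilon>\<^sup>2 * s)\<^sup>2 / Z \<le> (\<epsilon>\<^sup>2 * s)\<^sup>2 / (\<epsilon> * \<alpha> q)"
      using Zge \<beta>[of q] by (intro divide_left_mono) auto
    then have "\<mu>' * (\<epsilon>\<^sup>2 * M - (\<epsilon>\<^sup>2 * s)\<^sup>2 / (\<epsilon> * \<alpha> q)) \<le> \<mu>' * (\<epsilon>\<^sup>2 * M - (\<epsilon>\<^sup>2 * s)\<^sup>2 / Z)"
      using \<mu>'(2) by (intro mult_left_mono) auto
    ultimately have "\<mu>' * (\<epsilon>\<^sup>2 * M - (\<epsilon>\<^sup>2 * s)\<^sup>2 / (\<epsilon> * \<alpha> q)) \<le> \<epsilon> ^ 3 * (\<mu> * M)" by linarith
    moreover have "\<epsilon>\<^sup>2 * M - (\<epsilon>\<^sup>2 * s)\<^sup>2 / (\<epsilon> * \<alpha> q) = \<epsilon>\<^sup>2 * M * (1 - \<epsilon> * (s\<^sup>2 / (\<alpha> q * M)))"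
      using \<epsilon>(1) \<alpha>[of q] M by (simp add: field_simps power2_eq_square)
    ultimately have "(\<epsilon>\<^sup>2 * M) * (\<mu>' * (1 - \<epsilon> * (s\<^sup>2 / (\<alpha> q * M)))) \<le> (\<epsilon>\<^sup>2 * M) * (\<epsilon> * \<mu>)"
      by (simp add: power2_eq_square power3_eq_cube mult_ac)
    then have "\<mu>' * (1 - \<epsilon> * (s\<^sup>2 / (\<alpha> q * M))) \<le> \<epsilon> * \<mu>"
      using \<epsilon>(1) M by (simp only: mult_le_cancel_left_pos zero_less_power mult_pos_pos)
    moreover have "sip_gap c ?\<beta> 2 * (1 - \<epsilon> * (s\<^sup>2 / (\<alpha> q * M))) \<le> \<mu>' * (1 - \<epsilon> * (s\<^sup>2 / (\<alpha> q * M)))"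
      using sip_gap_le[OF c less_imp_le[OF \<beta>] \<mu>'(1)] \<mu>'(2) \<epsilon>(2) by (intro mult_right_mono) auto
    ultimately show "sip_gap c ?\<beta> 2 * (1 - \<epsilon> * (s\<^sup>2 / (\<alpha> q * M))) \<le> \<epsilon> * \<mu>" by linarith
  qed
qed

section \<open>Comparison of the gaps\<close>

lemma sip_gap_vs_two_particle_gap:
  fixes c :: "'v::finite \<Rightarrow> 'v \<Rightarrow> real"
  assumes graph: "connected_weighted_graph c" and \<beta>: "\<And>x. \<beta> x > 0" and k: "k \<ge> 2"
  shows "sip_gap c \<beta> 2 > 0" "sip_gap c \<beta> k \<le> sip_gap c \<beta> 2" "sip_gap c \<beta> k > 0"
    "sip_gap c \<beta> k \<in> sip_eigenvalues c \<beta> k"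
    "sip_gap c \<beta> k \<in> sip_eigenvalues c \<beta> 2 \<Longrightarrow> sip_gap c \<beta> k = sip_gap c \<beta> 2"
proof -
  have c: "\<And>x y. c x y \<ge> 0" and loop: "\<And>x. c x x = 0" and sym: "\<And>x y. c x y = c y x"
    using graph unfolding connected_weighted_graph_def by blast+
  have \<beta>': "\<beta> x \<ge> 0" for x using \<beta>[of x] by simp
  obtain \<mu> where \<mu>: "\<mu> \<in> sip_eigenvalues c \<beta> 2" "\<mu> > 0"
    using two_particle_spectral_bound[of c \<beta>, OF graph \<beta>] by blast
  then have "\<mu> \<noteq> 0" by simp
  note two = sip_gap_eigenvalue[OF c \<beta>' \<mu>(1) this]
  then show pos: "sip_gap c \<beta> 2 > 0" by simp
  have sub: "sip_eigenvalues c \<beta> 2 \<subseteq> sip_eigenvalues c \<beta> k"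
    by (rule sip_eigenvalues_2_subset[of c, OF sym loop k])
  show le: "sip_gap c \<beta> k \<le> sip_gap c \<beta> 2"
    using two sub by (intro sip_gap_le[OF c \<beta>']) auto
  have "\<mu> \<in> sip_eigenvalues c \<beta> k" using \<mu>(1) sub by blast
  from sip_gap_eigenvalue[OF c \<beta>' this \<open>\<mu> \<noteq> 0\<close>]
  show "sip_gap c \<beta> k > 0" "sip_gap c \<beta> k \<in> sip_eigenvalues c \<beta> k" by simp_all
  then show "sip_gap c \<beta> k = sip_gap c \<beta> 2" if "sip_gap c \<beta> k \<in> sip_eigenvalues c \<beta> 2"
    using sip_gap_le[OF c \<beta>' that] le by simp
qed

text \<open>If \<open>gap\<^sub>k\<close> lies below the level of the barrier, it is a two-particle eigenvalue and both gaps
  agree. Otherwise it exceeds a level arbitrarily close to \<open>\<epsilon> \<mu>\<close>, while the test kernel bounds the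
  two-particle gap by nearly \<open>\<epsilon> \<mu>\<close>. That \<open>\<mu>\<close> is positive follows from the positivity of the
  two-particle gap.\<close>

lemma eventually_sip_gap_gt:
  fixes c :: "'v::finite \<Rightarrow> 'v \<Rightarrow> real"
  assumes graph: "connected_weighted_graph c" and \<alpha>: "\<And>x. \<alpha> x > 0" and k: "k \<ge> 2"
    and \<theta>: "0 < \<theta>" "\<theta> < 1"
  shows "\<forall>\<^sub>F \<epsilon> in at_right 0. sip_gap c (\<lambda>x. \<epsilon> * \<alpha> x) k > \<theta> * sip_gap c (\<lambda>x. \<epsilon> * \<alpha> x) 2"
proof -
  have c: "\<And>x y. c x y \<ge> 0" and loop: "\<And>x. c x x = 0" and sym: "\<And>x y. c x y = c y x"
    using graph unfolding connected_weighted_graph_def by blast+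
  have k1: "k \<ge> 1" using k by simp
  let ?gap = "\<lambda>\<epsilon>. sip_gap c (\<lambda>x. \<epsilon> * \<alpha> x)"
  have gap: "?gap \<epsilon> 2 > 0" "?gap \<epsilon> k \<le> ?gap \<epsilon> 2" "?gap \<epsilon> k \<in> sip_eigenvalues c (\<lambda>x. \<epsilon> * \<alpha> x) k"
    "?gap \<epsilon> k \<in> sip_eigenvalues c (\<lambda>x. \<epsilon> * \<alpha> x) 2 \<Longrightarrow> ?gap \<epsilon> k = ?gap \<epsilon> 2"
    if "\<epsilon> > 0" for \<epsilon>
    using sip_gap_vs_two_particle_gap[OF graph _ k, of "\<lambda>x. \<epsilon> * \<alpha> x"] that \<alpha> by simp_all
  have ev0: "\<forall>\<^sub>F \<epsilon> in at_right 0. \<epsilon> > (0::real)" by (simp add: eventually_at_right_less)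
  show ?thesis
  proof (cases "\<exists>p q. p \<noteq> q \<and> c p q = 0")
    case True
    then obtain p q where pq: "p \<noteq> q" "c p q = 0" by blast
    obtain g0 \<mu> where g0: "\<And>x y. g0 x y = g0 y x" "\<And>x y. x = y \<or> c x y \<noteq> 0 \<Longrightarrow> g0 x y = 0"
      and mass: "kernel_inner (walk_pair_weight \<alpha>) g0 g0 > 0"
      and energy: "kernel_energy (walk_pair_conductance c \<alpha>) g0 g0 = \<mu> * kernel_inner (walk_pair_weight \<alpha>) g0 g0"
      and barrier: "\<And>\<delta>. \<delta> > 0 \<Longrightarrow> \<exists>g \<kappa>. pair_barrier c \<alpha> (\<mu> - \<delta>) \<kappa> g"
      using metastable_barrier[of c \<alpha> p q, OF sym c \<alpha> pq] by blast
    obtain C where C: "\<And>\<epsilon>. 0 < \<epsilon> \<Longrightarrow> \<epsilon> * C < 1 \<Longrightarrow> ?gap \<epsilon> 2 * (1 - \<epsilon> * C) \<le> \<epsilon> * \<mu>"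
      using two_particle_gap_metastable_bound[OF graph \<alpha> g0 mass energy] by blast
    have evC: "\<forall>\<^sub>F \<epsilon> in at_right 0. 1 + \<epsilon> * (- C) > r" if "r < 1" for r :: real
      using order_tendstoD(1)[OF tendsto_affine_at_right_0 that] .
    have evC0: "\<forall>\<^sub>F \<epsilon> in at_right 0. 1 + \<epsilon> * (- C) > 0" by (rule evC) simp
    have \<mu>: "\<mu> > 0"
    proof -
      have "\<forall>\<^sub>F \<epsilon> in at_right 0. (0::real) < \<epsilon> \<and> 1 + \<epsilon> * (- C) > 0"
        using ev0 evC0 by eventually_elim simp
      from eventually_happens'[OF trivial_limit_at_right_real this]
      obtain \<epsilon> :: real where \<epsilon>: "\<epsilon> > 0" "1 + \<epsilon> * (- C) > 0" by blast
      have "0 < ?gap \<epsilon> 2 * (1 - \<epsilon> * C)" using gap(1)[OF \<epsilon>(1)] \<epsilon>(2) by simp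
      also have "\<dots> \<le> \<epsilon> * \<mu>" using C[OF \<epsilon>(1)] \<epsilon>(2) by simp
      finally show ?thesis using \<epsilon>(1) by (simp add: zero_less_mult_iff)
    qed
    \<comment> \<open>Spend half of the allowed relative error \<open>1 - \<theta>\<close> on the barrier, the rest on the test function.\<close>
    define t where "t = (1 + \<theta>) / 2"
    have t: "0 < t" "t < 1" "\<theta> < t" using \<theta> by (simp_all add: t_def)
    have "\<mu> * (1 - t) > 0" using \<mu> t by simp
    from barrier[OF this] obtain g \<kappa> where g: "pair_barrier c \<alpha> (\<mu> - \<mu> * (1 - t)) \<kappa> g"
      by blast
    have "\<theta> / t < 1" using t by simp
    show ?thesis
      using low_eigenvalues_are_two_particle_eigenvalues[of c \<alpha> k, OF sym c loop \<alpha> k1 g]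
        evC[OF \<open>\<theta> / t < 1\<close>] evC0 ev0
    proof eventually_elim
      case (elim \<epsilon>)
      note gap' = gap[OF elim(4)]
      show ?case
      proof (cases "?gap \<epsilon> k \<le> \<epsilon> * (\<mu> - \<mu> * (1 - t))")
        case True
        then have "?gap \<epsilon> k = ?gap \<epsilon> 2" using elim(1) gap'(3,4) by blast
        then show ?thesis using gap'(1) \<theta> by simp
      next
        case False
        have "\<theta> * ?gap \<epsilon> 2 = t * (?gap \<epsilon> 2 * (\<theta> / t))" using t by simp
        also have "\<dots> \<le> t * (?gap \<epsilon> 2 * (1 - \<epsilon> * C))"
          using elim(2) gap'(1) t by (intro mult_left_mono) auto
        also have "\<dots> \<le> t * (\<epsilon> * \<mu>)" using C[OF elim(4)] elim(3) t by (intro mult_left_mono) auto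
        also have "\<dots> < ?gap \<epsilon> k" using False by (simp add: algebra_simps)
        finally show ?thesis .
      qed
    qed
  next
    case False
    \<comment> \<open>On a complete graph no pair of distinct sites is metastable, so the zero kernel is a barrier at every level.\<close>
    obtain b where b: "\<And>\<epsilon>. 0 < \<epsilon> \<Longrightarrow> \<epsilon> \<le> 1 \<Longrightarrow> ?gap \<epsilon> 2 \<le> \<epsilon> * b"
      using two_particle_gap_linear_bound[of c \<alpha>, OF graph \<alpha>] by blast
    have zero: "pair_barrier c \<alpha> b 1 (\<lambda>_ _. 0)" using False by (auto simp: pair_barrier_def)
    have low: "\<forall>\<^sub>F \<epsilon> in at_right 0. \<forall>\<mu>' \<in> sip_eigenvalues c (\<lambda>x. \<epsilon> * \<alpha> x) k. \<mu>' \<le> \<epsilon> * b \<longrightarrow>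
           \<mu>' \<in> sip_eigenvalues c (\<lambda>x. \<epsilon> * \<alpha> x) 2"
      by (rule low_eigenvalues_are_two_particle_eigenvalues[OF sym c loop \<alpha> k1 zero])
    have "\<forall>\<^sub>F \<epsilon> in at_right 0. 0 + \<epsilon> * 1 < (1::real)"
      by (rule order_tendstoD(2)[OF tendsto_affine_at_right_0]) simp
    with low ev0 show ?thesis
    proof eventually_elim
      case (elim \<epsilon>)
      note gap' = gap[OF elim(2)]
      have "?gap \<epsilon> k \<le> \<epsilon> * b" using b[of \<epsilon>] elim(2,3) gap'(2) by simp
      then have "?gap \<epsilon> k = ?gap \<epsilon> 2" using elim(1) gap'(3,4) by blast
      then show ?case using gap'(1) \<theta> by simp
    qed
  qed
qed

theorem theorem2p3:
  fixes c :: "'v::finite \<Rightarrow> 'v \<Rightarrow> real"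
    and \<alpha> :: "'v \<Rightarrow> real"
    and k :: nat
  assumes "connected_weighted_graph c"
    and "\<And>x. \<alpha> x > 0"
    and "k \<ge> 2"
  shows "((\<lambda>\<epsilon>. sip_gap c (\<lambda>x. \<epsilon> * \<alpha> x) k / sip_gap c (\<lambda>x. \<epsilon> * \<alpha> x) 2) \<longlongrightarrow> 1) (at_right 0)"
proof (rule order_tendstoI)
  have ev0: "\<forall>\<^sub>F \<epsilon> in at_right 0. \<epsilon> > (0::real)" by (simp add: eventually_at_right_less)
  have pos: "sip_gap c (\<lambda>x. \<epsilon> * \<alpha> x) 2 > 0" "sip_gap c (\<lambda>x. \<epsilon> * \<alpha> x) k \<le> sip_gap c (\<lambda>x. \<epsilon> * \<alpha> x) 2"
    if "\<epsilon> > 0" for \<epsilon>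
    using sip_gap_vs_two_particle_gap[OF assms(1) _ assms(3), of "\<lambda>x. \<epsilon> * \<alpha> x"] that assms(2) by simp_all
  fix a :: real
  show "\<forall>\<^sub>F \<epsilon> in at_right 0. a < sip_gap c (\<lambda>x. \<epsilon> * \<alpha> x) k / sip_gap c (\<lambda>x. \<epsilon> * \<alpha> x) 2" if "a < 1"
  proof -
    define \<theta> where "\<theta> = max a (1 / 2)"
    have "0 < \<theta>" "\<theta> < 1" "a \<le> \<theta>" using that by (simp_all add: \<theta>_def)
    from eventually_sip_gap_gt[of c \<alpha> k \<theta>, OF assms this(1,2)] ev0 show ?thesis
    proof eventually_elim
      case (elim \<epsilon>)
      then have "\<theta> < sip_gap c (\<lambda>x. \<epsilon> * \<alpha> x) k / sip_gap c (\<lambda>x. \<epsilon> * \<alpha> x) 2"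
        using pos(1)[OF elim(2)] by (simp add: pos_less_divide_eq)
      with \<open>a \<le> \<theta>\<close> show ?case by linarith
    qed
  qed
  show "\<forall>\<^sub>F \<epsilon> in at_right 0. sip_gap c (\<lambda>x. \<epsilon> * \<alpha> x) k / sip_gap c (\<lambda>x. \<epsilon> * \<alpha> x) 2 < a" if "a > 1"
    using ev0
  proof eventually_elim
    case (elim \<epsilon>)
    then have "sip_gap c (\<lambda>x. \<epsilon> * \<alpha> x) k / sip_gap c (\<lambda>x. \<epsilon> * \<alpha> x) 2 \<le> 1"
      using pos[OF elim] by (simp add: pos_divide_le_eq)
    with that show ?case by linarith
  qed
qed

end
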